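(* Let $d\ge 3$ and let $D_N\subset U^d$ be an arbitrary $N$-point set. Suppose that an integer $s$ satisfies $$s\ge \log N+\frac12(d-2)\log(d-2)+2d+\log d.$$ Then $$\mathcal M_{s,\infty}[D_N]>\gamma_\infty(d)(\log N)^{\frac12 d},\qquad \gamma_\infty(d)=2^{-2d-1}(d-2)^{-\frac12(d-2)}.$$ In particular, there exist dyadic shifts $T\in\mathbb Q^d(2^s)$ such that $\mathcal L_\infty[D_N\oplus T]>\gamma_\infty(d)(\log N)^{\frac12 d}$.
   Context: $\log$ denotes the logarithm in base 2. $U^d=[0,1)^d$. For a finite set $D\subset U^d$ and $Y=(y_1,\dots,y_d)\in U^d$, let $B_Y=[0,y_1)\times\dots\times[0,y_d)$ and $\mathcal L[D,Y]=|D\cap B_Y|-|D|\,y_1\cdots y_d$; $\mathcal L_\infty[D]=\sup_{Y\in U^d}|\mathcal L[D,Y]|$. Every $y\in[0,1)$ has a unique dyadic expansion $y=\sum_{a\ge1}\eta_a(y)2^{-a}$, $\eta_a(y)\in\{0,1\}$, with infinitely many zero digits. $\mathbb Q(2^s)=\{m2^{-s}:0\le m\le 2^s-1\}$, $\mathbb Q^d(2^s)=\mathbb Q(2^s)^d$. For $x\in[0,1)$ and $t\in\mathbb Q(2^s)$, $x\oplus t$ is defined by $\eta_a(x\oplus t)=\eta_a(x)+\eta_a(t)\bmod 2$; for $X\in U^d$, $T\in\mathbb Q^d(2^s)$ this is applied coordinatewise, and $D\oplus T=\{X\oplus T:X\in D\}$. The mean $L_\infty$-discrepancy is $\mathcal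 M_{s,\infty}[D]=\max_{T\in\mathbb Q^d(2^s)}\mathcal L_\infty[D\oplus T]$. *)

theory Defs
  imports "HOL-Analysis.Analysis"
begin

definition unit_cube :: "(real ^ 'n) set" where
  "unit_cube = {X. \<forall>i. 0 \<le> X $ i \<and> X $ i < 1}"

definition anchored_box :: "real ^ 'n \<Rightarrow> (real ^ 'n) set" where
  "anchored_box Y = {X. \<forall>i. 0 \<le> X $ i \<and> X $ i < Y $ i}"

definition local_discrepancy :: "(real ^ 'n) set \<Rightarrow> real ^ 'n \<Rightarrow> real" where
  "local_discrepancy D Y = real (card (D \<inter> anchored_box Y)) - real (card D) * (\<Prod>i\<in>UNIV. Y $ i)"

definition Linf_discrepancy :: "(real ^ 'n) set \<Rightarrow> real" where
  "Linf_discrepancy D = (SUP Y\<in>unit_cube. \<bar>local_discrepancy D Y\<bar>)"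

text \<open>Digits carry the indices \<open>a \<ge> 1\<close>; the slot \<open>e 0\<close> is fixed to \<open>0\<close> so that the digit
  sequence is unique as a function on \<open>nat\<close> and the series may start at \<open>0\<close>.\<close>

definition dyadic_expansion :: "(nat \<Rightarrow> nat) \<Rightarrow> real \<Rightarrow> bool" where
  "dyadic_expansion e y \<longleftrightarrow>
     e 0 = 0 \<and> (\<forall>a. e a \<in> {0, 1}) \<and> infinite {a. e a = 0} \<and> (\<lambda>a. real (e a) / 2 ^ a) sums y"

definition dyadic_digit :: "nat \<Rightarrow> real \<Rightarrow> nat" where
  "dyadic_digit a y = (THE e. dyadic_expansion e y) a"

definition dyadic_rationals :: "nat \<Rightarrow> real set" where
  "dyadic_rationals s = {real m / 2 ^ s | m :: nat. m \<le> 2 ^ s - 1}"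

definition dyadic_rational_points :: "nat \<Rightarrow> (real ^ 'n) set" where
  "dyadic_rational_points s = {T. \<forall>i. T $ i \<in> dyadic_rationals s}"

text \<open>Meaningful for \<open>x\<close> in \<open>[0,1)\<close> and \<open>t\<close> a dyadic rational in \<open>[0,1)\<close>, see \<open>dyadic_add_ex1\<close> below:
  for two arbitrary reals the digitwise sum may have only finitely many zeros.\<close>

definition dyadic_add :: "real \<Rightarrow> real \<Rightarrow> real" where
  "dyadic_add x t = (THE z. z \<in> {0..<1} \<and>
     (\<forall>a\<ge>1. dyadic_digit a z = (dyadic_digit a x + dyadic_digit a t) mod 2))"

definition dyadic_shift :: "real ^ 'n \<Rightarrow> real ^ 'n \<Rightarrow> real ^ 'n" where
  "dyadic_shift X T = (\<chi> i. dyadic_add (X $ i) (T $ i))"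

definition shift_set :: "(real ^ 'n) set \<Rightarrow> real ^ 'n \<Rightarrow> (real ^ 'n) set" where
  "shift_set D T = (\<lambda>X. dyadic_shift X T) ` D"

definition mean_Linf_discrepancy :: "nat \<Rightarrow> (real ^ 'n) set \<Rightarrow> real" where
  "mean_Linf_discrepancy s D =
     Max ((\<lambda>T. Linf_discrepancy (shift_set D T)) ` dyadic_rational_points s)"

definition gamma_inf :: "nat \<Rightarrow> real" where
  "gamma_inf d = 2 powr (- 2 * real d - 1) * (real d - 2) powr (- (real d - 2) / 2)"

subsection \<open>Well-definedness of the notions above\<close>

lemma floor_double: "\<lfloor>2 ^ Suc n * y\<rfloor> = 2 * \<lfloor>2 ^ n * y\<rfloor> + \<lfloor>2 ^ Suc n * (y::real)\<rfloor> mod 2"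
proof -
  have "\<lfloor>2 ^ n * y\<rfloor> = \<lfloor>2 ^ Suc n * y / real_of_int 2\<rfloor>" by simp
  also have "\<dots> = \<lfloor>2 ^ Suc n * y\<rfloor> div 2"
    using floor_divide_real_eq_div[of 2 "2 ^ Suc n * y"] by simp
  finally show ?thesis by (metis mult_div_mod_eq)
qed

lemma dyadic_expansion_floor:
  assumes "dyadic_expansion e y"
  shows "\<lfloor>2 ^ n * y\<rfloor> = (\<Sum>a\<le>n. int (e a) * 2 ^ (n - a))"
proof -
  let ?f = "\<lambda>a. real (e a) / 2 ^ a"
  have s: "?f sums y" and inf: "infinite {a. e a = 0}"
    using assms by (auto simp: dyadic_expansion_def)
  have e01: "e a \<in> {0,1}" for a
    using assms unfolding dyadic_expansion_def by blast
  have tail: "(\<lambda>a. ?f (a + Suc n)) sums (y - (\<Sum>a<Suc n. ?f a))"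
    using s by (rule sums_split_initial_segment)
  have geo: "(\<lambda>a. (1/2) ^ Suc a / 2 ^ n) sums (1 / 2 ^ n :: real)"
    using sums_divide[OF power_half_series, of "2 ^ n :: real"] by simp
  have le: "?f (a + Suc n) \<le> (1/2) ^ Suc a / 2 ^ n" for a
    using e01[of "a + Suc n"] by (auto simp: power_add power_divide field_simps)
  obtain k where k: "k > n" "e k = 0"
    using inf by (metis (mono_tags, lifting) infinite_nat_iff_unbounded mem_Collect_eq)
  have "?f ((k - Suc n) + Suc n) < (1/2) ^ Suc (k - Suc n) / 2 ^ n"
    using k by simp
  then have pos: "0 < (1/2) ^ Suc (k - Suc n) / 2 ^ n - ?f ((k - Suc n) + Suc n)" by linarith
  have dsum: "(\<lambda>a. (1/2) ^ Suc a / 2 ^ n - ?f (a + Suc n)) sums (1 / 2 ^ n - (y - (\<Sum>a<Suc n. ?f a)))"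
    by (rule sums_diff[OF geo tail])
  have "0 < (\<Sum>a. (1/2) ^ Suc a / 2 ^ n - ?f (a + Suc n))"
    by (rule suminf_pos2[OF sums_summable[OF dsum] _ pos]) (use le in \<open>simp only: diff_ge_0_iff_ge\<close>)
  then have lt: "y - (\<Sum>a<Suc n. ?f a) < 1 / 2 ^ n"
    by (simp only: sums_unique[OF dsum, symmetric] diff_gt_0_iff_gt)
  have ge: "0 \<le> y - (\<Sum>a<Suc n. ?f a)"
    by (rule sums_le[OF _ sums_zero tail]) simp
  have eq: "2 ^ n * (\<Sum>a<Suc n. ?f a) = real_of_int (\<Sum>a\<le>n. int (e a) * 2 ^ (n - a))"
    unfolding lessThan_Suc_atMost sum_distrib_left of_int_sum
    by (rule sum.cong) (auto simp: power_diff[where 'a = real])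
  have "0 \<le> 2 ^ n * (y - (\<Sum>a<Suc n. ?f a))"
    by (rule mult_nonneg_nonneg[OF _ ge]) simp
  moreover have "2 ^ n * (y - (\<Sum>a<Suc n. ?f a)) < 2 ^ n * (1 / 2 ^ n)"
    by (rule mult_strict_left_mono[OF lt]) simp
  ultimately have "0 \<le> 2 ^ n * y - real_of_int (\<Sum>a\<le>n. int (e a) * 2 ^ (n - a))"
    "2 ^ n * y - real_of_int (\<Sum>a\<le>n. int (e a) * 2 ^ (n - a)) < 2 ^ n * (1 / 2 ^ n)"
    by (simp_all only: right_diff_distrib eq)
  then show ?thesis
    by (intro floor_unique) (simp_all del: of_int_sum)
qed

lemma dyadic_expansion_eq_floor_mod:
  assumes "dyadic_expansion e y"
  shows "e n = nat (\<lfloor>2 ^ n * y\<rfloor> mod 2)"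
proof (cases n)
  case 0
  then show ?thesis
    using dyadic_expansion_floor[OF assms, of 0] assms by (simp add: dyadic_expansion_def)
next
  case (Suc m)
  have "(\<Sum>a\<le>Suc m. int (e a) * 2 ^ (Suc m - a)) = 2 * (\<Sum>a\<le>m. int (e a) * 2 ^ (m - a)) + int (e (Suc m))"
    by (auto simp: sum_distrib_left Suc_diff_le intro!: sum.cong)
  then have "\<lfloor>2 ^ n * y\<rfloor> mod 2 = int (e n) mod 2"
    using dyadic_expansion_floor[OF assms, of n] Suc by simp
  moreover have "e n \<in> {0,1}" using assms unfolding dyadic_expansion_def by blast
  ultimately show ?thesis by auto
qed

lemma dyadic_expansion_floor_mod:
  fixes y :: real
  assumes y: "0 \<le> y" "y < 1"
  shows "dyadic_expansion (\<lambda>n. nat (\<lfloor>2 ^ n * y\<rfloor> mod 2)) y" (is "dyadic_expansion ?e y")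
proof -
  have e0: "?e 0 = 0"
  proof -
    have "\<lfloor>y\<rfloor> = 0" using y by (simp add: floor_eq_iff)
    then show ?thesis by simp
  qed
  have e01: "?e a \<in> {0,1}" for a by auto
  have rec: "\<lfloor>2 ^ Suc n * y\<rfloor> = 2 * \<lfloor>2 ^ n * y\<rfloor> + int (?e (Suc n))" for n
    using floor_double[of n y] by simp
  have part: "(\<Sum>a<Suc n. real (?e a) / 2 ^ a) = of_int \<lfloor>2 ^ n * y\<rfloor> / 2 ^ n" for n
  proof (induction n)
    case 0
    have "\<lfloor>y\<rfloor> = 0" using y by (simp add: floor_eq_iff)
    then show ?case by simp
  next
    case (Suc n)
    have "real_of_int \<lfloor>2 ^ Suc n * y\<rfloor> = 2 * real_of_int \<lfloor>2 ^ n * y\<rfloor> + real (?e (Suc n))"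
      by (subst rec) simp
    then show ?case
      using Suc by (subst sum.lessThan_Suc) (simp add: field_simps)
  qed
  have bnd: "norm (of_int \<lfloor>2 ^ n * y\<rfloor> / 2 ^ n - y) \<le> (1/2) ^ n" for n
  proof -
    have "\<bar>of_int \<lfloor>2 ^ n * y\<rfloor> - 2 ^ n * y\<bar> \<le> 1" by linarith
    moreover have "of_int \<lfloor>2 ^ n * y\<rfloor> / 2 ^ n - y = (of_int \<lfloor>2 ^ n * y\<rfloor> - 2 ^ n * y) / 2 ^ n"
      by (simp add: field_simps)
    ultimately show ?thesis by (simp add: power_divide divide_right_mono abs_divide)
  qed
  have "(\<lambda>n. of_int \<lfloor>2 ^ n * y\<rfloor> / 2 ^ n - y) \<longlonglongrightarrow> 0"
    by (rule Lim_null_comparison[OF always_eventually[OF allI[OF bnd]]], rule LIMSEQ_power_zero) simp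
  then have lim: "(\<lambda>n. of_int \<lfloor>2 ^ n * y\<rfloor> / 2 ^ n) \<longlonglongrightarrow> y"
    by (simp add: LIM_zero_iff)
  have sums: "(\<lambda>a. real (?e a) / 2 ^ a) sums y"
    unfolding sums_def by (subst filterlim_sequentially_Suc[symmetric]) (simp only: part lim)
  have inf: "infinite {a. ?e a = 0}"
  proof
    assume "finite {a. ?e a = 0}"
    then obtain n where "\<forall>a\<in>{a. ?e a = 0}. a \<le> n"
      using finite_nat_set_iff_bounded_le by blast
    then have one: "?e a = 1" if "a > n" for a
      using e01[of a] that by fastforce
    have "\<lfloor>2 ^ (n + m) * y\<rfloor> + 1 = 2 ^ m * (\<lfloor>2 ^ n * y\<rfloor> + 1)" for m
    proof (induction m)
      case (Suc m)
      have "\<lfloor>2 ^ (n + Suc m) * y\<rfloor> = 2 * \<lfloor>2 ^ (n + m) * y\<rfloor> + 1"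
        using rec[of "n + m"] one[of "Suc (n + m)"] by simp
      then show ?case using Suc by (simp add: algebra_simps)
    qed simp
    then have "real_of_int (\<lfloor>2 ^ (n + m) * y\<rfloor> + 1) = 2 ^ m * of_int (\<lfloor>2 ^ n * y\<rfloor> + 1)" for m
      by (metis of_int_mult of_int_numeral of_int_power)
    then have "2 ^ m * real_of_int (\<lfloor>2 ^ n * y\<rfloor> + 1) \<le> 2 ^ m * (2 ^ n * y) + 1" for m
      by (smt (verit) floor_correct mult.assoc mult.commute of_int_add of_int_1 power_add)
    then have *: "2 ^ m * (real_of_int (\<lfloor>2 ^ n * y\<rfloor> + 1) - 2 ^ n * y) \<le> 1" for m
      by (simp add: right_diff_distrib diff_le_eq add.commute)
    have "real_of_int (\<lfloor>2 ^ n * y\<rfloor> + 1) - 2 ^ n * y > 0" by linarith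
    then obtain m where "2 ^ m > 1 / (real_of_int (\<lfloor>2 ^ n * y\<rfloor> + 1) - 2 ^ n * y)"
      using real_arch_pow[of 2] by fastforce
    then show False
      using *[of m] \<open>_ > 0\<close> by (simp add: field_simps)
  qed
  show ?thesis unfolding dyadic_expansion_def using e0 e01 inf sums by blast
qed

lemma dyadic_expansion_ex1:
  assumes "y \<in> {0..<1}"
  shows "\<exists>!e. dyadic_expansion e y"
proof (rule ex1I)
  show "dyadic_expansion (\<lambda>n. nat (\<lfloor>2 ^ n * y\<rfloor> mod 2)) y"
    using assms by (intro dyadic_expansion_floor_mod) auto
qed (rule ext, rule dyadic_expansion_eq_floor_mod)

lemma dyadic_digit_eq:
  assumes "dyadic_expansion e y"
  shows "dyadic_digit a y = e a"
proof -
  have "(THE e. dyadic_expansion e y) = e"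
    using assms dyadic_expansion_eq_floor_mod by (intro the_equality ext) metis+
  then show ?thesis by (simp add: dyadic_digit_def)
qed

lemma dyadic_digit_floor:
  assumes "y \<in> {0..<1}"
  shows "dyadic_digit a y = nat (\<lfloor>2 ^ a * y\<rfloor> mod 2)"
  using dyadic_digit_eq[OF dyadic_expansion_floor_mod[of y]] assms by simp

lemma dyadic_rationals_bounds: "t \<in> dyadic_rationals s \<Longrightarrow> t \<in> {0..<1}"
proof -
  assume "t \<in> dyadic_rationals s"
  then obtain m :: nat where m: "t = real m / 2 ^ s" "m \<le> 2 ^ s - 1"
    by (auto simp: dyadic_rationals_def)
  have "m < 2 ^ s" using m(2) by (metis Suc_pred' le_imp_less_Suc pos2 zero_less_power)
  then have "real m < 2 ^ s" by (metis of_nat_less_iff of_nat_numeral of_nat_power)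
  then show ?thesis using m(1) by simp
qed

lemma dyadic_digit_rational_eq_0:
  assumes "t \<in> dyadic_rationals s" "a > s"
  shows "dyadic_digit a t = 0"
proof -
  obtain m :: nat where m: "t = real m / 2 ^ s"
    using assms by (auto simp: dyadic_rationals_def)
  obtain k where k: "a = s + Suc k" using assms(2) less_imp_Suc_add by auto
  have "2 ^ a * t = of_int (2 * (2 ^ k * int m))" using m k by (simp add: power_add)
  then have "\<lfloor>2 ^ a * t\<rfloor> = 2 * (2 ^ k * int m)" by (metis floor_of_int)
  then show ?thesis using dyadic_digit_floor[OF dyadic_rationals_bounds[OF assms(1)]] by simp
qed

lemma dyadic_add_ex1:
  assumes x: "x \<in> {0..<1}" and t: "t \<in> dyadic_rationals s"
  shows "\<exists>!z. z \<in> {0..<1} \<and>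
           (\<forall>a\<ge>1. dyadic_digit a z = (dyadic_digit a x + dyadic_digit a t) mod 2)"
proof -
  define f where "f a = (dyadic_digit a x + dyadic_digit a t) mod 2" for a
  have ex: "dyadic_expansion (\<lambda>a. dyadic_digit a y) y" if "y \<in> {0..<1}" for y
    using dyadic_expansion_floor_mod[of y] dyadic_digit_floor[of y] that by simp
  have t1: "t \<in> {0..<1}" using dyadic_rationals_bounds[OF t] .
  have x0: "dyadic_digit 0 x = 0" "dyadic_digit 0 t = 0"
    using ex[OF x] ex[OF t1] by (auto simp: dyadic_expansion_def)
  have f0: "f 0 = 0" by (simp add: f_def x0)
  have f01: "f a \<in> {0,1}" for a by (auto simp: f_def)
  have feq: "f a = dyadic_digit a x" if "a > s" for a
  proof -
    have "dyadic_digit a x \<in> {0,1}" using ex[OF x] unfolding dyadic_expansion_def by blast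
    then show ?thesis using dyadic_digit_rational_eq_0[OF t that] by (auto simp: f_def)
  qed
  have inf: "infinite {a. f a = 0}"
  proof
    assume "finite {a. f a = 0}"
    then have "finite ({a. f a = 0} \<union> {..s})" by simp
    moreover have "{a. dyadic_digit a x = 0} \<subseteq> {a. f a = 0} \<union> {..s}"
      using feq by (auto simp: not_le)
    ultimately have "finite {a. dyadic_digit a x = 0}" by (rule rev_finite_subset)
    then show False using ex[OF x] by (simp add: dyadic_expansion_def)
  qed
  have "summable (\<lambda>a. real (f a) / 2 ^ a)"
  proof (rule summable_comparison_test')
    show "summable (\<lambda>a. (1/2) ^ a :: real)" by (simp add: summable_geometric)
    show "norm (real (f a) / 2 ^ a) \<le> (1/2) ^ a" if "a \<ge> 0" for a
      using f01[of a] by (auto simp: power_divide)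
  qed
  then obtain z where z: "(\<lambda>a. real (f a) / 2 ^ a) sums z" by (auto simp: summable_def)
  have ez: "dyadic_expansion f z" using f0 f01 inf z unfolding dyadic_expansion_def by blast
  have "\<lfloor>z\<rfloor> = 0" using dyadic_expansion_floor[OF ez, of 0] f0 by simp
  then have z01: "z \<in> {0..<1}" by (auto simp: floor_eq_iff)
  show ?thesis
  proof (rule ex1I[of _ z])
    show "z \<in> {0..<1} \<and>
           (\<forall>a\<ge>1. dyadic_digit a z = (dyadic_digit a x + dyadic_digit a t) mod 2)"
      using z01 dyadic_digit_eq[OF ez] by (simp add: f_def)
  next
    fix w assume w: "w \<in> {0..<1} \<and>
           (\<forall>a\<ge>1. dyadic_digit a w = (dyadic_digit a x + dyadic_digit a t) mod 2)"
    have ew: "dyadic_expansion (\<lambda>a. dyadic_digit a w) w" using ex w by blast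
    have "dyadic_digit a w = f a" for a
    proof (cases "a = 0")
      case True then show ?thesis using ew f0 by (auto simp: dyadic_expansion_def)
    next
      case False then show ?thesis using w by (simp add: f_def)
    qed
    then have "(\<lambda>a. real (f a) / 2 ^ a) sums w" using ew by (simp add: dyadic_expansion_def)
    then show "w = z" using z sums_unique2 by blast
  qed
qed

lemma finite_dyadic_rational_points:
  "finite (dyadic_rational_points s :: (real ^ 'n) set)"
proof -
  have "dyadic_rationals s = (\<lambda>m. real m / 2 ^ s) ` {m. m \<le> 2 ^ s - 1}"
    by (auto simp: dyadic_rationals_def)
  then have "finite (dyadic_rationals s)" by simp
  then have "finite (vec_lambda ` (UNIV \<rightarrow>\<^sub>E dyadic_rationals s) :: (real ^ 'n) set)"
    by (intro finite_imageI finite_PiE) auto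
  moreover have "dyadic_rational_points s \<subseteq> (vec_lambda ` (UNIV \<rightarrow>\<^sub>E dyadic_rationals s) :: (real ^ 'n) set)"
  proof
    fix T :: "real ^ 'n" assume "T \<in> dyadic_rational_points s"
    then show "T \<in> vec_lambda ` (UNIV \<rightarrow>\<^sub>E dyadic_rationals s)"
      by (intro image_eqI[of _ _ "\<lambda>i. T $ i"]) (auto simp: dyadic_rational_points_def)
  qed
  ultimately show ?thesis by (rule finite_subset[rotated])
qed

lemma dyadic_rational_points_nonempty: "0 \<in> dyadic_rational_points s"
  by (auto simp: dyadic_rational_points_def dyadic_rationals_def intro!: exI[of _ 0])

lemma bdd_above_local_discrepancy:
  fixes D :: "(real ^ 'n) set"
  assumes "finite D"
  shows "bdd_above ((\<lambda>Y. \<bar>local_discrepancy D Y\<bar>) ` unit_cube)"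
proof (rule bdd_aboveI2)
  fix Y :: "real ^ 'n" assume Y: "Y \<in> unit_cube"
  have p: "0 \<le> (\<Prod>i\<in>UNIV. Y $ i)" "(\<Prod>i\<in>UNIV. Y $ i) \<le> 1"
    using Y by (auto simp: unit_cube_def less_imp_le intro!: prod_nonneg prod_le_1)
  have "card (D \<inter> anchored_box Y) \<le> card D" using assms by (intro card_mono) auto
  moreover have "real (card D) * (\<Prod>i\<in>UNIV. Y $ i) \<le> real (card D)"
    using p by (simp add: mult_left_le)
  moreover have "0 \<le> real (card D) * (\<Prod>i\<in>UNIV. Y $ i)" using p by simp
  ultimately show "\<bar>local_discrepancy D Y\<bar> \<le> real (card D)"
    unfolding local_discrepancy_def by linarith
qed

end

theory Submission
  imports Defs
begin

text \<open>Shift by the corner \<open>Y\<close> of the test box itself. Whether \<open>x \<oplus> y < y\<close> depends only on the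
  leading digit of \<open>x\<close>: it must stand at a place where \<open>y\<close> has the digit 1. Hence
  \<open>\<L>[D \<oplus> Y, Y]\<close> is the sum, over the vectors \<open>a\<close> such that every \<open>y\<^sub>i\<close> has the digit 1 at the place
  \<open>a\<^sub>i\<close>, of the discrepancies \<open>\<lambda>(a)\<close> of \<open>D\<close> in dyadic boxes with edges \<open>2 ^ (- a\<^sub>i)\<close>, and the digits
  of \<open>Y\<close> are at our disposal. Choosing them optimally in one coordinate produces an \<open>l\<^sup>1\<close> norm;
  averaging over them in the other \<open>d - 1\<close> coordinates produces, by Khinchin's inequality, an \<open>l\<^sup>2\<close>
  norm. If \<open>2 ^ n \<le> 3 N < 2 ^ (n + 1)\<close>, then \<open>N / 2 ^ n\<close> has distance at least \<open>1 / 3\<close> to the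
  integers, so \<open>|\<lambda>(a)| \<ge> 1 / 3\<close> whenever \<open>\<Sum> a\<^sub>i = n\<close>, whatever \<open>D\<close> is. Up to a factor depending on \<open>d\<close>,
  the maximum over \<open>Y\<close> is therefore at least the sum of the square roots of the binomial coefficients
  \<open>j choose (d - 2)\<close> with \<open>j \<le> n - 2\<close>, which has order \<open>n powr (d / 2)\<close>. When
  \<open>log N \<le> 8 (d - 2)\<close> the claimed bound is below \<open>1 / 2\<close>, and every nonempty finite set has
  discrepancy at least \<open>1 / 2\<close>.\<close>

subsection \<open>Khinchin's inequality\<close>

text \<open>For finite S this is (-1)^|S \<inter> B|: B encodes the sign vector that is -1 exactly
  on B, and S a monomial in the signs.\<close>

definition walsh :: "'a set \<Rightarrow> 'a set \<Rightarrow> real" where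
  "walsh S B = (\<Prod>e\<in>S. if e \<in> B then - 1 else 1)"

text \<open>The sum over S factorises into a product over e \<in> A, and an element of exactly one
  of B and C contributes the factor -1 + 1 = 0.\<close>

lemma walsh_sum_mult:
  assumes "finite A" "B \<subseteq> A" "C \<subseteq> A"
  shows "(\<Sum>S\<in>Pow A. walsh S B * walsh S C) = (if B = C then 2 ^ card A else 0)"
proof -
  let ?\<sigma> = "\<lambda>B e. if e \<in> B then - 1 else 1 :: real"
  have "(\<Sum>S\<in>Pow A. walsh S B * walsh S C) = (\<Prod>e\<in>A. ?\<sigma> B e * ?\<sigma> C e + 1)"
    unfolding prod_add[OF assms(1)] by (simp add: walsh_def prod.distrib)
  also have "\<dots> = (if B = C then 2 ^ card A else 0)"
  proof (cases "B = C")
    case True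
    then have "(\<Prod>e\<in>A. ?\<sigma> B e * ?\<sigma> C e + 1) = (\<Prod>e\<in>A. 2)"
      by (intro prod.cong) auto
    then show ?thesis using True by simp
  next
    case False
    then obtain e where "e \<in> A" "(e \<in> B) \<noteq> (e \<in> C)" using assms by blast
    then have "?\<sigma> B e * ?\<sigma> C e + 1 = 0" by auto
    then have "(\<Prod>e\<in>A. ?\<sigma> B e * ?\<sigma> C e + 1) = 0"
      using \<open>e \<in> A\<close> assms(1) by (intro prod_zero) blast+
    then show ?thesis using False by simp
  qed
  finally show ?thesis .
qed

text \<open>Left unnormalised, so Parseval's identity carries the factor
  \<open>2 ^ card A\<close>.\<close>

definition walsh_transform :: "'a set \<Rightarrow> ('a set \<Rightarrow> real) \<Rightarrow> 'a set \<Rightarrow> real" where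
  "walsh_transform A f S = (\<Sum>B\<in>Pow A. walsh S B * f B)"

lemma walsh_parseval:
  assumes A: "finite A"
  shows "(\<Sum>S\<in>Pow A. walsh_transform A f S * walsh_transform A g S)
           = 2 ^ card A * (\<Sum>B\<in>Pow A. f B * g B)"
proof -
  have "(\<Sum>S\<in>Pow A. walsh_transform A f S * walsh_transform A g S)
      = (\<Sum>S\<in>Pow A. \<Sum>B\<in>Pow A. \<Sum>C\<in>Pow A. f B * g C * (walsh S B * walsh S C))"
    by (simp add: walsh_transform_def sum_product mult_ac)
  also have "\<dots> = (\<Sum>B\<in>Pow A. \<Sum>C\<in>Pow A. \<Sum>S\<in>Pow A. f B * g C * (walsh S B * walsh S C))"
    by (subst sum.swap, rule sum.cong[OF refl], rule sum.swap)
  also have "\<dots> = (\<Sum>B\<in>Pow A. \<Sum>C\<in>Pow A. if B = C then f B * g B * 2 ^ card A else 0)"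
    using walsh_sum_mult[OF A] by (intro sum.cong refl) (auto simp flip: sum_distrib_left)
  also have "\<dots> = (\<Sum>B\<in>Pow A. f B * g B * 2 ^ card A)"
    using A by (simp add: sum.delta)
  finally show ?thesis by (simp add: sum_distrib_left mult_ac)
qed

text \<open>Flipping the membership of e is an involution of the subsets of A that multiplies
  \<open>walsh S\<close> by the sign of e in S, so it acts diagonally on the transform.\<close>

lemma walsh_transform_flip:
  assumes A: "finite A" and "e \<in> A" "S \<subseteq> A"
  shows "walsh_transform A (\<lambda>B. f (if e \<in> B then B - {e} else insert e B)) S
           = (if e \<in> S then - 1 else 1) * walsh_transform A f S"
proof -
  let ?\<phi> = "\<lambda>B. if e \<in> B then B - {e} else insert e B"
  have S: "finite S" using assms finite_subset by blast
  have w: "walsh S (?\<phi> B) = (if e \<in> S then - 1 else 1) * walsh S B" for B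
  proof (cases "e \<in> S")
    case True
    show ?thesis
      unfolding walsh_def prod.remove[OF S True] using True by (auto intro!: prod.cong)
  next
    case False
    then show ?thesis unfolding walsh_def by (auto intro!: prod.cong)
  qed
  have "walsh_transform A (\<lambda>B. f (?\<phi> B)) S = (\<Sum>B\<in>Pow A. walsh S (?\<phi> B) * f B)"
    unfolding walsh_transform_def
    by (rule sum.reindex_bij_witness[where i = ?\<phi> and j = ?\<phi>])
      (use \<open>e \<in> A\<close> in \<open>auto simp: insert_absorb split: if_splits\<close>)
  then show ?thesis by (simp add: w walsh_transform_def sum_distrib_left mult_ac)
qed

text \<open>Passing to the complement reverses every sign, hence negates each Walsh function of odd
  degree.\<close>

lemma walsh_transform_even:
  assumes A: "finite A" and S: "S \<subseteq> A" and even: "\<And>B. B \<subseteq> A \<Longrightarrow> f (A - B) = f B"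
    and odd: "odd (card S)"
  shows "walsh_transform A f S = 0"
proof -
  have w: "walsh S (A - B) = - walsh S B" for B
  proof -
    have "walsh S (A - B) = (\<Prod>e\<in>S. - 1 * (if e \<in> B then - 1 else 1))"
      unfolding walsh_def using S by (intro prod.cong) auto
    also have "\<dots> = (-1) ^ card S * walsh S B"
      unfolding walsh_def prod.distrib by simp
    finally show ?thesis using odd by simp
  qed
  have "walsh_transform A f S = (\<Sum>B\<in>Pow A. walsh S (A - B) * f B)"
    unfolding walsh_transform_def
    by (rule sum.reindex_bij_witness[where i = "\<lambda>B. A - B" and j = "\<lambda>B. A - B"])
      (auto simp: even double_diff)
  also have "\<dots> = - walsh_transform A f S"
    by (simp add: w walsh_transform_def sum_negf)
  finally show ?thesis by simp
qed

text \<open>A spectral gap argument: the sum over neighbours acts on the Walsh function of S as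
  multiplication by n - 2|S|, where n is the size of A. Evenness removes |S| = 1, so every S except
  the empty one has factor at most n - 4 or transform 0. Against the assumed factor n - 2 this
  leaves only the mean of f on the right.\<close>

lemma sum_squares_even_le:
  assumes A: "finite A" and even: "\<And>B. B \<subseteq> A \<Longrightarrow> f (A - B) = f B"
    and nonneg: "\<And>B. B \<subseteq> A \<Longrightarrow> 0 \<le> f B"
    and flip: "\<And>B. B \<subseteq> A \<Longrightarrow>
      (real (card A) - 2) * f B \<le> (\<Sum>e\<in>A. f (if e \<in> B then B - {e} else insert e B))"
  shows "2 ^ card A * (\<Sum>B\<in>Pow A. f B * f B) \<le> 2 * (\<Sum>B\<in>Pow A. f B) ^ 2"
proof -
  let ?F = "walsh_transform A f" and ?n = "real (card A)"
  let ?\<phi> = "\<lambda>e B. if e \<in> B then B - {e} else insert e B"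
  have F0: "?F {} = (\<Sum>B\<in>Pow A. f B)" by (simp add: walsh_transform_def walsh_def)
  have "2 ^ card A * ((?n - 2) * (\<Sum>B\<in>Pow A. f B * f B))
      = 2 ^ card A * (\<Sum>B\<in>Pow A. f B * ((?n - 2) * f B))"
    by (simp add: sum_distrib_left mult_ac)
  also have "\<dots> \<le> 2 ^ card A * (\<Sum>B\<in>Pow A. f B * (\<Sum>e\<in>A. f (?\<phi> e B)))"
    using nonneg flip by (intro mult_left_mono sum_mono) auto
  also have "\<dots> = (\<Sum>e\<in>A. 2 ^ card A * (\<Sum>B\<in>Pow A. f B * f (?\<phi> e B)))"
    unfolding sum_distrib_left by (rule sum.swap)
  also have "\<dots> = (\<Sum>e\<in>A. \<Sum>S\<in>Pow A. (if e \<in> S then - 1 else 1) * (?F S * ?F S))"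
    by (rule sum.cong[OF refl], subst walsh_parseval[OF A, symmetric], rule sum.cong[OF refl])
      (simp add: walsh_transform_flip[OF A])
  also have "\<dots> = (\<Sum>S\<in>Pow A. (?n - 2 * real (card S)) * (?F S * ?F S))"
  proof (subst sum.swap, rule sum.cong[OF refl])
    fix S assume S: "S \<in> Pow A"
    have "(\<Sum>e\<in>A. if e \<in> S then - 1 else 1 :: real) = (\<Sum>e\<in>A. 1 - 2 * indicator S e)"
      by (intro sum.cong) auto
    also have "\<dots> = ?n - 2 * real (card S)"
      using A S
      by (simp add: sum_subtractf indicator_def sum.If_cases Int_absorb1 flip: sum_distrib_left)
    finally show "(\<Sum>e\<in>A. (if e \<in> S then - 1 else 1) * (?F S * ?F S))
        = (?n - 2 * real (card S)) * (?F S * ?F S)"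
      by (simp only: sum_distrib_right[symmetric])
  qed
  \<comment> \<open>The factor n at the empty set exceeds n - 4 by 4, which is the extra
    term.\<close>
  also have "\<dots> \<le> (\<Sum>S\<in>Pow A. (?n - 4) * (?F S * ?F S) + (if S = {} then 4 * (?F S * ?F S) else 0))"
  proof (rule sum_mono)
    fix S assume S: "S \<in> Pow A"
    consider "S = {}" | "S \<noteq> {}" "odd (card S)" | "S \<noteq> {}" "even (card S)" by blast
    then show "(?n - 2 * real (card S)) * (?F S * ?F S)
        \<le> (?n - 4) * (?F S * ?F S) + (if S = {} then 4 * (?F S * ?F S) else 0)"
    proof cases
      case 2
      then have "?F S = 0" by (intro walsh_transform_even[OF A]) (use S even in auto)
      then show ?thesis by simp
    next
      case 3
      moreover have "card S \<noteq> 0" using 3 S A finite_subset by fastforce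
      ultimately have "2 \<le> card S" by (auto elim!: evenE)
      then show ?thesis using 3 by (auto intro!: mult_right_mono)
    qed (simp add: algebra_simps)
  qed
  also have "\<dots> = (?n - 4) * (2 ^ card A * (\<Sum>B\<in>Pow A. f B * f B)) + 4 * (\<Sum>B\<in>Pow A. f B) ^ 2"
    using A by (simp add: sum.distrib walsh_parseval F0 power2_eq_square flip: sum_distrib_left)
  finally show ?thesis by (simp add: algebra_simps)
qed

text \<open>Pairing B with \<open>insert x B\<close> cancels the cross terms: (c + t)^2 + (-c + t)^2
  = 2 c^2 + 2 t^2.\<close>

lemma sum_signed_squares:
  fixes c :: "'a \<Rightarrow> real"
  assumes "finite A"
  shows "(\<Sum>B\<in>Pow A. (\<Sum>e\<in>A. if e \<in> B then - c e else c e) ^ 2) = 2 ^ card A * (\<Sum>e\<in>A. c e ^ 2)"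
  using assms
proof (induction A)
  case (insert x A)
  let ?s = "\<lambda>A B. \<Sum>e\<in>A. if e \<in> B then - c e else c e"
  have inj: "inj_on (insert x) (Pow A)" and disj: "Pow A \<inter> insert x ` Pow A = {}"
    using insert by (auto simp: inj_on_def)
  have "?s A (insert x B) = ?s A B" for B
    using insert by (intro sum.cong) auto
  moreover have "x \<notin> B" if "B \<in> Pow A" for B using insert that by auto
  ultimately have "(\<Sum>B\<in>Pow (insert x A). ?s (insert x A) B ^ 2)
      = (\<Sum>B\<in>Pow A. (c x + ?s A B) ^ 2) + (\<Sum>B\<in>Pow A. (- c x + ?s A B) ^ 2)"
    unfolding Pow_insert using insert inj disj
    by (subst sum.union_disjoint) (auto simp: sum.reindex intro!: arg_cong2[of _ _ _ _ "(+)"] sum.cong)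
  also have "\<dots> = (\<Sum>B\<in>Pow A. 2 * c x ^ 2 + 2 * ?s A B ^ 2)"
    by (simp add: power2_sum power2_diff sum.distrib[symmetric] algebra_simps)
  also have "\<dots> = 2 ^ card (insert x A) * (\<Sum>e\<in>insert x A. c e ^ 2)"
    using insert by (simp add: sum.distrib card_Pow algebra_simps flip: sum_distrib_left)
  finally show ?case .
qed simp

text \<open>Szarek's optimal constant, by the argument of Latala and Oleszkiewicz: \<open>f = |\<Sum> \<plusminus>c|\<close> is even,
  so its Walsh expansion has no term of degree 1, and the triangle inequality gives the hypothesis
  on the neighbours of \<open>B\<close> in \<open>sum_squares_even_le\<close>.\<close>

lemma khinchin:
  fixes c :: "'a \<Rightarrow> real"
  assumes A: "finite A"
  shows "2 ^ card A * sqrt (\<Sum>e\<in>A. c e ^ 2)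
           \<le> sqrt 2 * (\<Sum>B\<in>Pow A. \<bar>\<Sum>e\<in>A. if e \<in> B then - c e else c e\<bar>)"
proof -
  define s where "s B = (\<Sum>e\<in>A. if e \<in> B then - c e else c e)" for B
  have s_diff: "s (A - B) = - s B" for B
    unfolding s_def sum_negf[symmetric] by (intro sum.cong) auto
  have s_flip: "s (if e \<in> B then B - {e} else insert e B) = s B - 2 * (if e \<in> B then - c e else c e)"
    if "e \<in> A" for e B
  proof -
    have "s (if e \<in> B then B - {e} else insert e B)
        = (\<Sum>a\<in>A. (if a \<in> B then - c a else c a) - (if a = e then 2 * (if e \<in> B then - c e else c e) else 0))"
      unfolding s_def by (intro sum.cong) auto
    then show ?thesis using A that by (simp add: sum_subtractf s_def)
  qed
  have "2 ^ card A * (\<Sum>B\<in>Pow A. \<bar>s B\<bar> * \<bar>s B\<bar>) \<le> 2 * (\<Sum>B\<in>Pow A. \<bar>s B\<bar>) ^ 2"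
  proof (rule sum_squares_even_le[OF A])
    fix B assume "B \<subseteq> A"
    \<comment> \<open>Flipping e subtracts twice its signed term, and over all e \<in> A these
      changes add up to 2 \<open>s B\<close>.\<close>
    have "(real (card A) - 2) * s B = (\<Sum>e\<in>A. s B - 2 * (if e \<in> B then - c e else c e))"
      unfolding sum_subtractf sum_distrib_left[symmetric] s_def[symmetric] by (simp add: algebra_simps)
    also have "\<dots> = (\<Sum>e\<in>A. s (if e \<in> B then B - {e} else insert e B))"
      by (simp add: s_flip)
    finally have "\<bar>(real (card A) - 2) * s B\<bar> \<le> (\<Sum>e\<in>A. \<bar>s (if e \<in> B then B - {e} else insert e B)\<bar>)"
      by (simp only: sum_abs)
    moreover have "(real (card A) - 2) * \<bar>s B\<bar> \<le> \<bar>(real (card A) - 2) * s B\<bar>"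
      unfolding abs_mult by (intro mult_right_mono) auto
    ultimately show "(real (card A) - 2) * \<bar>s B\<bar> \<le> (\<Sum>e\<in>A. \<bar>s (if e \<in> B then B - {e} else insert e B)\<bar>)"
      by linarith
  qed (auto simp: s_diff)
  then have "2 ^ card A * (2 ^ card A * (\<Sum>e\<in>A. c e ^ 2)) \<le> 2 * (\<Sum>B\<in>Pow A. \<bar>s B\<bar>) ^ 2"
    using sum_signed_squares[OF A, of c] by (simp add: s_def power2_eq_square)
  then have "sqrt ((2 ^ card A) ^ 2 * (\<Sum>e\<in>A. c e ^ 2)) \<le> sqrt (2 * (\<Sum>B\<in>Pow A. \<bar>s B\<bar>) ^ 2)"
    by (simp add: power2_eq_square mult.assoc)
  then show ?thesis
    by (simp add: real_sqrt_mult sum_nonneg s_def)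
qed

text \<open>A signed sum is the sum over A - B minus the sum over B. The triangle inequality and the
  symmetry under complements cost a factor 2, which turns sqrt 2 into sqrt 8.\<close>

lemma khinchin_subset_sums:
  fixes c :: "'a \<Rightarrow> real"
  assumes A: "finite A"
  shows "2 ^ card A * sqrt (\<Sum>e\<in>A. c e ^ 2) \<le> sqrt 8 * (\<Sum>B\<in>Pow A. \<bar>\<Sum>e\<in>B. c e\<bar>)"
proof -
  have "(\<Sum>B\<in>Pow A. \<bar>\<Sum>e\<in>A. if e \<in> B then - c e else c e\<bar>)
      \<le> (\<Sum>B\<in>Pow A. \<bar>sum c (A - B)\<bar> + \<bar>sum c B\<bar>)"
  proof (rule sum_mono)
    fix B assume "B \<in> Pow A"
    then have "(\<Sum>e\<in>A. if e \<in> B then - c e else c e) = sum c (A - B) - sum c B"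
      using A by (simp add: sum.If_cases sum_negf Int_absorb1 Diff_eq)
    then show "\<bar>\<Sum>e\<in>A. if e \<in> B then - c e else c e\<bar> \<le> \<bar>sum c (A - B)\<bar> + \<bar>sum c B\<bar>"
      by linarith
  qed
  also have "\<dots> = (\<Sum>B\<in>Pow A. \<bar>sum c (A - B)\<bar>) + (\<Sum>B\<in>Pow A. \<bar>sum c B\<bar>)"
    by (rule sum.distrib)
  also have "(\<Sum>B\<in>Pow A. \<bar>sum c (A - B)\<bar>) = (\<Sum>B\<in>Pow A. \<bar>sum c B\<bar>)"
    by (rule sum.reindex_bij_witness[where i = "\<lambda>B. A - B" and j = "\<lambda>B. A - B"])
      (auto simp: double_diff)
  finally have "sqrt 2 * (\<Sum>B\<in>Pow A. \<bar>\<Sum>e\<in>A. if e \<in> B then - c e else c e\<bar>)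
      \<le> sqrt 2 * (2 * (\<Sum>B\<in>Pow A. \<bar>sum c B\<bar>))"
    by (intro mult_left_mono) auto
  also have "\<dots> = sqrt 8 * (\<Sum>B\<in>Pow A. \<bar>sum c B\<bar>)"
    using real_sqrt_mult[of 4 2] by simp
  finally show ?thesis using khinchin[OF A, of c] by linarith
qed

section \<open>Khinchin's inequality in several coordinates\<close>

lemma sum_PiE_insert:
  assumes "i \<notin> I"
  shows "sum f (PiE (insert i I) E) = (\<Sum>e\<in>E i. \<Sum>g\<in>PiE I E. f (g(i := e)))"
proof -
  have "sum f (PiE (insert i I) E) = (\<Sum>(e, g)\<in>E i \<times> PiE I E. f (g(i := e)))"
    unfolding PiE_insert_eq using inj_combinator[OF assms, of E]
    by (subst sum.reindex) (auto simp: case_prod_unfold)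
  then show ?thesis by (simp add: sum.cartesian_product)
qed

lemma minkowski_sum_sqrt:
  "sqrt (\<Sum>e\<in>A. (\<Sum>j\<in>J. g j e) ^ 2) \<le> (\<Sum>j\<in>J. sqrt (\<Sum>e\<in>A. g j e ^ 2))"
proof (induction J rule: infinite_finite_induct)
  case (insert j J)
  have "L2_set (\<lambda>e. g j e + (\<Sum>j\<in>J. g j e)) A \<le> L2_set (g j) A + L2_set (\<lambda>e. \<Sum>j\<in>J. g j e) A"
    by (rule L2_set_triangle_ineq)
  then show ?case using insert by (simp add: L2_set_def)
qed auto

text \<open>Induction on the coordinates: the induction hypothesis is used for each value e of the
  new coordinate, Minkowski's inequality moves the l^2 norm over e inside the sum over E, and the
  one-dimensional inequality then treats that norm.\<close>

lemma khinchin_tensor: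
  fixes \<Lambda> :: "('i \<Rightarrow> 'a) \<Rightarrow> real"
  assumes I: "finite I" and A: "finite A"
  shows "(2 ^ card A) ^ card I * sqrt (\<Sum>a\<in>PiE I (\<lambda>_. A). \<Lambda> a ^ 2)
           \<le> sqrt 8 ^ card I * (\<Sum>E\<in>PiE I (\<lambda>_. Pow A). \<bar>\<Sum>a\<in>PiE I E. \<Lambda> a\<bar>)"
  using I
proof (induction I arbitrary: \<Lambda>)
  case empty
  then show ?case by simp
next
  case (insert i I)
  let ?P = "PiE I (\<lambda>_. A)" and ?\<E> = "PiE I (\<lambda>_. Pow A)" and ?k = "card I"
  define G where "G E e = (\<Sum>g\<in>PiE I E. \<Lambda> (g(i := e)))" for E e
  have "(2 ^ card A) ^ Suc ?k * sqrt (\<Sum>e\<in>A. \<Sum>g\<in>?P. \<Lambda> (g(i := e)) ^ 2)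
      = 2 ^ card A * sqrt (\<Sum>e\<in>A. ((2 ^ card A) ^ ?k * sqrt (\<Sum>g\<in>?P. \<Lambda> (g(i := e)) ^ 2)) ^ 2)"
    by (simp add: power_mult_distrib sum_nonneg real_sqrt_mult flip: sum_distrib_left)
  also have "\<dots> \<le> 2 ^ card A * sqrt (\<Sum>e\<in>A. (sqrt 8 ^ ?k * (\<Sum>E\<in>?\<E>. \<bar>G E e\<bar>)) ^ 2)"
    unfolding G_def
    by (intro mult_left_mono real_sqrt_le_mono sum_mono power_mono insert.IH) (auto intro!: mult_nonneg_nonneg sum_nonneg)
  also have "\<dots> = 2 ^ card A * (sqrt 8 ^ ?k * sqrt (\<Sum>e\<in>A. (\<Sum>E\<in>?\<E>. \<bar>G E e\<bar>) ^ 2))"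
    by (simp add: power_mult_distrib real_sqrt_mult flip: sum_distrib_left)
  also have "\<dots> \<le> 2 ^ card A * (sqrt 8 ^ ?k * (\<Sum>E\<in>?\<E>. sqrt (\<Sum>e\<in>A. \<bar>G E e\<bar> ^ 2)))"
    by (intro mult_left_mono minkowski_sum_sqrt) auto
  also have "\<dots> = sqrt 8 ^ ?k * (\<Sum>E\<in>?\<E>. 2 ^ card A * sqrt (\<Sum>e\<in>A. G E e ^ 2))"
    by (simp add: sum_distrib_left mult_ac)
  also have "\<dots> \<le> sqrt 8 ^ ?k * (\<Sum>E\<in>?\<E>. sqrt 8 * (\<Sum>B\<in>Pow A. \<bar>\<Sum>e\<in>B. G E e\<bar>))"
    by (intro mult_left_mono sum_mono khinchin_subset_sums A) auto
  also have "\<dots> = sqrt 8 ^ Suc ?k * (\<Sum>B\<in>Pow A. \<Sum>E\<in>?\<E>. \<bar>\<Sum>e\<in>B. G E e\<bar>)"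
    by (subst sum.swap) (simp add: mult_ac flip: sum_distrib_left)
  also have "(\<Sum>B\<in>Pow A. \<Sum>E\<in>?\<E>. \<bar>\<Sum>e\<in>B. G E e\<bar>)
      = (\<Sum>E\<in>PiE (insert i I) (\<lambda>_. Pow A). \<bar>\<Sum>a\<in>PiE (insert i I) E. \<Lambda> a\<bar>)"
  proof -
    have "PiE I (E(i := B)) = PiE I E" for E :: "'i \<Rightarrow> 'a set" and B
      using insert.hyps(2) by (intro PiE_cong) auto
    then show ?thesis
      by (simp add: sum_PiE_insert[OF insert.hyps(2)] G_def)
  qed
  finally show ?case
    by (simp only: sum_PiE_insert[OF insert.hyps(2)] card_insert_disjoint[OF insert.hyps])
qed

text \<open>The l^1 norm is the difference of the subset sums over the nonnegative and over the
  negative terms.\<close>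

lemma sum_abs_le_twice_subset_sum:
  fixes c :: "'a \<Rightarrow> real"
  assumes A: "finite A" and K: "\<And>B. B \<subseteq> A \<Longrightarrow> \<bar>sum c B\<bar> \<le> K"
  shows "(\<Sum>e\<in>A. \<bar>c e\<bar>) \<le> 2 * K"
proof -
  have "(\<Sum>e\<in>A. \<bar>c e\<bar>) = sum c {e \<in> A. c e \<ge> 0} - sum c {e \<in> A. \<not> c e \<ge> 0}"
    using A by (simp add: abs_if sum.If_cases sum_negf Int_def not_less not_le conj_commute)
  then show ?thesis
    using K[of "{e \<in> A. c e \<ge> 0}"] K[of "{e \<in> A. \<not> c e \<ge> 0}"] by auto
qed

text \<open>One coordinate is optimised, which costs no square root; the other ones are averaged.\<close>

lemma sum_sqrt_le_of_subset_sums: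
  fixes \<Lambda> :: "('i \<Rightarrow> 'a) \<Rightarrow> real"
  assumes I: "finite I" "i \<notin> I" and A: "finite A"
    and K: "\<And>E. E \<in> PiE (insert i I) (\<lambda>_. Pow A) \<Longrightarrow> \<bar>\<Sum>a\<in>PiE (insert i I) E. \<Lambda> a\<bar> \<le> K"
  shows "(\<Sum>b\<in>A. sqrt (\<Sum>a\<in>PiE I (\<lambda>_. A). \<Lambda> (a(i := b)) ^ 2)) \<le> 2 * sqrt 8 ^ card I * K"
proof -
  let ?\<E> = "PiE I (\<lambda>_. Pow A)"
  define G where "G E e = (\<Sum>g\<in>PiE I E. \<Lambda> (g(i := e)))" for E e
  have *: "(\<Sum>e\<in>A. \<bar>G E e\<bar>) \<le> 2 * K" if E: "E \<in> ?\<E>" for E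
  proof (rule sum_abs_le_twice_subset_sum[OF A])
    fix B assume B: "B \<subseteq> A"
    have "PiE I (E(i := B)) = PiE I E" using I(2) by (intro PiE_cong) auto
    then have "(\<Sum>a\<in>PiE (insert i I) (E(i := B)). \<Lambda> a) = sum (G E) B"
      by (simp add: sum_PiE_insert[OF I(2)] G_def)
    moreover have "E(i := B) \<in> PiE (insert i I) (\<lambda>_. Pow A)"
      using E B by (auto simp: PiE_insert_eq intro!: image_eqI[of _ _ "(B, E)"])
    ultimately show "\<bar>sum (G E) B\<bar> \<le> K" using K by metis
  qed
  have "(2 ^ card A) ^ card I * (\<Sum>b\<in>A. sqrt (\<Sum>a\<in>PiE I (\<lambda>_. A). \<Lambda> (a(i := b)) ^ 2))
      \<le> (\<Sum>b\<in>A. sqrt 8 ^ card I * (\<Sum>E\<in>?\<E>. \<bar>G E b\<bar>))"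
    by (subst sum_distrib_left, rule sum_mono) (simp only: G_def khinchin_tensor[OF I(1) A])
  also have "\<dots> = sqrt 8 ^ card I * (\<Sum>E\<in>?\<E>. \<Sum>b\<in>A. \<bar>G E b\<bar>)"
    by (subst sum.swap) (simp flip: sum_distrib_left)
  also have "\<dots> \<le> sqrt 8 ^ card I * (\<Sum>E\<in>?\<E>. 2 * K)"
    by (intro mult_left_mono sum_mono *) auto
  \<comment> \<open>The number of families E is exactly the factor on the left, so it
    cancels.\<close>
  also have "\<dots> = (2 ^ card A) ^ card I * (2 * sqrt 8 ^ card I * K)"
    using I A by (simp add: card_PiE card_Pow)
  finally show ?thesis by simp
qed

section \<open>Counting compositions\<close>

text \<open>Compositions of k + 1 into r + 1 positive parts; k < s guarantees that the upper limit s
  excludes none. Giving the value k - j to one coordinate leaves j + 1 for the others, and the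
  hockey-stick identity adds up the counts.\<close>

lemma card_compositions_ge:
  assumes "finite I" "card I = Suc r" "k < s"
  shows "card {a \<in> PiE I (\<lambda>_. {1..s}). sum a I = Suc k} \<ge> k choose r"
  using assms
proof (induction r arbitrary: I k)
  case 0
  then obtain i where I: "I = {i}" by (auto simp: card_Suc_eq)
  have "(\<lambda>j. if j = i then Suc k else undefined) \<in> {a \<in> PiE I (\<lambda>_. {1..s}). sum a I = Suc k}"
    using I 0 by auto
  then have "card {a \<in> PiE I (\<lambda>_. {1..s}). sum a I = Suc k} > 0"
    using 0 by (auto simp: card_gt_0_iff intro!: finite_PiE finite_Collect_conjI)
  then show ?case by simp
next
  case (Suc r)
  then obtain i J where I: "I = insert i J" "i \<notin> J" "card J = Suc r"
    by (metis card_Suc_eq)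
  have J: "finite J" using I Suc by auto
  define S where "S k = {a \<in> PiE J (\<lambda>_. {1..s}). sum a J = Suc k}" for k
  have fS: "finite (S k)" for k unfolding S_def using J by (auto intro!: finite_PiE)
  \<comment> \<open>\<open>inj_combinator\<close> needs a component at i as well; UNIV there admits
    every value k - j.\<close>
  have "PiE J (\<lambda>j. if j = i then UNIV else {1..s}) = PiE J (\<lambda>_. {1..s})"
    using I(2) by (intro PiE_cong) auto
  then have upd: "inj_on (\<lambda>(e, g). g(i := e)) (UNIV \<times> PiE J (\<lambda>_. {1..s}))"
    using inj_combinator[OF I(2), of "\<lambda>j. if j = i then UNIV else {1..s}"] by simp
  have inj: "inj_on (\<lambda>(j, g). g(i := k - j)) (SIGMA j:{..<k}. S j)"
  proof (rule inj_onI)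
    fix p q assume p: "p \<in> (SIGMA j:{..<k}. S j)" and q: "q \<in> (SIGMA j:{..<k}. S j)"
      and eq: "(\<lambda>(j, g). g(i := k - j)) p = (\<lambda>(j, g). g(i := k - j)) q"
    have "(k - fst p, snd p) = (k - fst q, snd q)"
      by (rule inj_onD[OF upd]) (use eq p q in \<open>auto simp: case_prod_unfold S_def\<close>)
    then show "p = q" using p q by (auto simp: prod_eq_iff)
  qed
  have "k choose Suc r = (\<Sum>j<k. j choose r)"
    by (cases k) (simp_all add: sum_choose_upper lessThan_Suc_atMost)
  also have "\<dots> \<le> (\<Sum>j<k. card (S j))"
    unfolding S_def using Suc.prems J I by (intro sum_mono Suc.IH) auto
  also have "\<dots> = card ((\<lambda>(j, g). g(i := k - j)) ` (SIGMA j:{..<k}. S j))"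
    using inj fS by (simp add: card_image card_SigmaI)
  also have "\<dots> \<le> card {a \<in> PiE I (\<lambda>_. {1..s}). sum a I = Suc k}"
  proof (rule card_mono)
    show "finite {a \<in> PiE I (\<lambda>_. {1..s}). sum a I = Suc k}"
      using Suc.prems by (auto intro!: finite_PiE)
    have "sum (g(i := e)) J = sum g J" for g :: "'a \<Rightarrow> nat" and e
      using I by (intro sum.cong) auto
    then show "(\<lambda>(j, g). g(i := k - j)) ` (SIGMA j:{..<k}. S j)
        \<subseteq> {a \<in> PiE I (\<lambda>_. {1..s}). sum a I = Suc k}"
      using Suc.prems I J by (auto simp: S_def PiE_insert_eq intro!: image_eqI[of _ _ "(_, _)"])
  qed
  finally show ?case .
qed

subsection \<open>Dyadic shifts and dyadic boxes\<close>

lemma dyadic_expansion_dyadic_digit: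
  "y \<in> {0..<1} \<Longrightarrow> dyadic_expansion (\<lambda>a. dyadic_digit a y) y"
  using dyadic_expansion_floor_mod[of y] dyadic_digit_floor[of y] by simp

lemma dyadic_digit_le_1: "y \<in> {0..<1} \<Longrightarrow> dyadic_digit a y \<in> {0, 1}"
  using dyadic_expansion_dyadic_digit[of y] unfolding dyadic_expansion_def by blast

lemma dyadic_digit_0: "y \<in> {0..<1} \<Longrightarrow> dyadic_digit 0 y = 0"
  using dyadic_expansion_dyadic_digit[of y] unfolding dyadic_expansion_def by blast

lemma dyadic_digit_cong_imp_eq:
  assumes x: "x \<in> {0..<1}" and y: "y \<in> {0..<1}"
    and eq: "\<And>a. a \<ge> 1 \<Longrightarrow> dyadic_digit a x = dyadic_digit a y"
  shows "x = y"
proof -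
  have "dyadic_digit a x = dyadic_digit a y" for a
    using eq[of a] dyadic_digit_0[OF x] dyadic_digit_0[OF y] by (cases "a = 0") auto
  then show ?thesis
    using dyadic_expansion_dyadic_digit[OF x] dyadic_expansion_dyadic_digit[OF y] sums_unique2
    unfolding dyadic_expansion_def by fastforce
qed

text \<open>The floors of 2^a x and 2^a y are the integers formed by the digits up to place a, and
  these already differ in the right direction.\<close>

lemma less_if_first_different_digit:
  assumes x: "x \<in> {0..<1}" and y: "y \<in> {0..<1}"
    and eq: "\<And>b. b < a \<Longrightarrow> dyadic_digit b x = dyadic_digit b y"
    and less: "dyadic_digit a x < dyadic_digit a y"
  shows "x < y"
proof -
  have "\<lfloor>2 ^ a * x\<rfloor> = (\<Sum>b<a. int (dyadic_digit b x) * 2 ^ (a - b)) + int (dyadic_digit a x)"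
    using dyadic_expansion_floor[OF dyadic_expansion_dyadic_digit[OF x], of a]
    by (simp add: lessThan_Suc_atMost[symmetric])
  also have "\<dots> < (\<Sum>b<a. int (dyadic_digit b y) * 2 ^ (a - b)) + int (dyadic_digit a y)"
    using eq less by simp
  also have "\<dots> = \<lfloor>2 ^ a * y\<rfloor>"
    using dyadic_expansion_floor[OF dyadic_expansion_dyadic_digit[OF y], of a]
    by (simp add: lessThan_Suc_atMost[symmetric])
  finally have "2 ^ a * x < 2 ^ a * y" by (metis floor_mono linorder_not_less)
  then show ?thesis by simp
qed

lemma
  assumes "x \<in> {0..<1}" and "t \<in> dyadic_rationals s"
  shows dyadic_add_in: "dyadic_add x t \<in> {0..<1}"
    and dyadic_digit_dyadic_add:
      "a \<ge> 1 \<Longrightarrow> dyadic_digit a (dyadic_add x t) = (dyadic_digit a x + dyadic_digit a t) mod 2"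
  using theI'[OF dyadic_add_ex1[OF assms]] unfolding dyadic_add_def by blast+

lemma inj_on_dyadic_add:
  assumes t: "t \<in> dyadic_rationals s"
  shows "inj_on (\<lambda>x. dyadic_add x t) {0..<1}"
proof (rule inj_onI)
  fix x y assume x: "x \<in> {0..<1::real}" and y: "y \<in> {0..<1::real}"
    and eq: "dyadic_add x t = dyadic_add y t"
  have "dyadic_digit a x = dyadic_digit a y" if "a \<ge> 1" for a
  proof -
    have "(dyadic_digit a x + dyadic_digit a t) mod 2 = (dyadic_digit a y + dyadic_digit a t) mod 2"
      using dyadic_digit_dyadic_add[OF x t that] dyadic_digit_dyadic_add[OF y t that] eq by simp
    then show ?thesis
      using dyadic_digit_le_1[OF x, of a] dyadic_digit_le_1[OF y, of a]
        dyadic_digit_le_1[OF dyadic_rationals_bounds[OF t], of a] by auto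
  qed
  then show "x = y" by (rule dyadic_digit_cong_imp_eq[OF x y])
qed

text \<open>The place is the least k with 1 \<le> 2^k x; minimality gives 2^k x < 2, so the floor
  there is 1 and all earlier floors are 0.\<close>

lemma ex_leading_digit:
  assumes x: "x \<in> {0<..<1}"
  obtains a where "a \<ge> 1" "x \<in> {1 / 2 ^ a..<2 / 2 ^ a}"
    "dyadic_digit a x = 1" "\<And>b. b < a \<Longrightarrow> dyadic_digit b x = 0"
proof -
  obtain k where "1 / x < 2 ^ k" using real_arch_pow[of 2] by auto
  then have k: "1 \<le> 2 ^ k * x" using x by (simp add: field_simps)
  define a where "a = (LEAST k. 1 \<le> 2 ^ k * x)"
  have a: "1 \<le> 2 ^ a * x" unfolding a_def using k by (rule LeastI)
  have small: "2 ^ b * x < 1" if "b < a" for b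
    using not_less_Least[of b "\<lambda>k. 1 \<le> 2 ^ k * x"] that by (simp add: a_def)
  have a1: "a \<ge> 1" using a x by (cases a) auto
  then have up: "2 ^ a * x < 2" using small[of "a - 1"] by (cases a) auto
  have x': "x \<in> {0..<1}" using x by auto
  show thesis
  proof (rule that[OF a1])
    show "x \<in> {1 / 2 ^ a..<2 / 2 ^ a}" using a up by (simp add: field_simps)
    have "\<lfloor>2 ^ a * x\<rfloor> = 1" using a up by (simp add: floor_eq_iff)
    then show "dyadic_digit a x = 1" using dyadic_digit_floor[OF x'] by simp
    show "dyadic_digit b x = 0" if "b < a" for b
    proof -
      have "\<lfloor>2 ^ b * x\<rfloor> = 0" using small[OF that] x by (simp add: floor_eq_iff)
      then show ?thesis using dyadic_digit_floor[OF x'] by simp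
    qed
  qed
qed

lemma dyadic_interval_unique:
  fixes x :: real
  assumes "x \<in> {1 / 2 ^ a..<2 / 2 ^ a}" "x \<in> {1 / 2 ^ b..<2 / 2 ^ b}"
  shows "a = b"
proof -
  have *: "\<not> a < b" if "x < 2 / 2 ^ b" "1 / 2 ^ a \<le> x" for a b
  proof
    assume "a < b"
    then have "(2::real) * 2 ^ a \<le> 2 ^ b" by (metis Suc_leI one_le_numeral power_Suc power_increasing)
    then have "2 / 2 ^ b \<le> (1::real) / 2 ^ a" by (simp add: field_simps)
    then show False using that by linarith
  qed
  show ?thesis using *[of b a] *[of a b] assms by auto
qed

text \<open>The coordinates of the shifts, which are at the same time the corners of the test boxes.\<close>

definition dyadic_point :: "nat set \<Rightarrow> real" where
  "dyadic_point E = (\<Sum>a\<in>E. 1 / 2 ^ a)"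

lemma dyadic_expansion_dyadic_point:
  assumes "finite E" "0 \<notin> E"
  shows "dyadic_expansion (\<lambda>a. if a \<in> E then 1 else 0) (dyadic_point E)"
proof -
  have "(\<lambda>a. real (if a \<in> E then 1 else 0) / 2 ^ a) sums (\<Sum>a\<in>E. real (if a \<in> E then 1 else 0) / 2 ^ a)"
    by (rule sums_finite[OF assms(1)]) simp
  moreover have "infinite {a. (if a \<in> E then 1 else 0::nat) = 0}"
    using assms(1) infinite_UNIV_nat
    by (metis (mono_tags, lifting) Compl_eq finite_compl mem_Collect_eq subsetI rev_finite_subset one_neq_zero)
  ultimately show ?thesis using assms by (simp add: dyadic_expansion_def dyadic_point_def)
qed

lemma dyadic_point_in_rationals:
  assumes "E \<subseteq> {1..s}"
  shows "dyadic_point E \<in> dyadic_rationals s"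
proof -
  have fin: "finite E" using assms finite_subset by blast
  have "dyadic_expansion (\<lambda>a. if a \<in> E then 1 else 0) (dyadic_point E)"
    using assms by (intro dyadic_expansion_dyadic_point[OF fin]) auto
  \<comment> \<open>At scale 0 the floor is the digit at place 0, which vanishes because 0 is not in
    E; hence the point is below 1.\<close>
  from dyadic_expansion_floor[OF this, of 0] assms
  have less1: "dyadic_point E < 1" by (auto simp: floor_eq_iff split: if_splits)
  define m :: nat where "m = (\<Sum>a\<in>E. 2 ^ (s - a))"
  have m: "dyadic_point E = real m / 2 ^ s"
    unfolding dyadic_point_def m_def of_nat_sum sum_divide_distrib using assms
    by (intro sum.cong) (auto simp: power_diff)
  then have "real m < real (2 ^ s)" using less1 by simp
  then show ?thesis using m unfolding dyadic_rationals_def of_nat_less_iff by fastforce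
qed

lemma dyadic_digit_dyadic_point:
  assumes "E \<subseteq> {1..s}"
  shows "dyadic_digit a (dyadic_point E) = (if a \<in> E then 1 else 0)"
  using assms finite_subset[OF assms] by (intro dyadic_digit_eq dyadic_expansion_dyadic_point) auto

text \<open>Shifting by the corner \<open>y\<close> itself flips exactly the digits of \<open>y\<close> at the places where \<open>x\<close> has
  the digit 1, so the comparison with \<open>y\<close> is decided by the leading digit of \<open>x\<close>.\<close>

lemma dyadic_add_less_iff:
  assumes E: "E \<subseteq> {1..s}" and x: "x \<in> {0..<1}"
  shows "dyadic_add x (dyadic_point E) < dyadic_point E \<longleftrightarrow> (\<exists>a\<in>E. x \<in> {1 / 2 ^ a..<2 / 2 ^ a})"
proof -
  define y where "y = dyadic_point E"
  have yr: "y \<in> dyadic_rationals s" unfolding y_def by (rule dyadic_point_in_rationals[OF E])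
  have y: "y \<in> {0..<1}" by (rule dyadic_rationals_bounds[OF yr])
  define z where "z = dyadic_add x y"
  have z: "z \<in> {0..<1}" unfolding z_def by (rule dyadic_add_in[OF x yr])
  have dz: "dyadic_digit a z = (dyadic_digit a x + dyadic_digit a y) mod 2" for a
    using dyadic_digit_dyadic_add[OF x yr, of a] dyadic_digit_0[OF x] dyadic_digit_0[OF y]
      dyadic_digit_0[OF z] unfolding z_def by (cases "a = 0") auto
  have dy: "dyadic_digit a y = (if a \<in> E then 1 else 0)" for a
    unfolding y_def by (rule dyadic_digit_dyadic_point[OF E])
  show ?thesis
  proof (cases "x = 0")
    case True
    \<comment> \<open>The point 0 has no leading digit: its shift is y itself, which is not below y,
      and no interval contains 0.\<close>
    have "dyadic_digit a x = 0" for a using dyadic_digit_floor[OF x] True by simp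
    then have "dyadic_digit a z = dyadic_digit a y" for a by (simp add: dz dy)
    then have "z = y" by (intro dyadic_digit_cong_imp_eq[OF z y])
    moreover have "x \<notin> {1 / 2 ^ a..<2 / 2 ^ a}" for a using True by (simp add: not_le)
    ultimately show ?thesis unfolding z_def y_def by auto
  next
    case False
    then have "x \<in> {0<..<1}" using x by auto
    then obtain a where a: "a \<ge> 1" "x \<in> {1 / 2 ^ a..<2 / 2 ^ a}" "dyadic_digit a x = 1"
      "\<And>b. b < a \<Longrightarrow> dyadic_digit b x = 0" using ex_leading_digit by blast
    have eq: "dyadic_digit b z = dyadic_digit b y" if "b < a" for b
      using a(4)[OF that] by (simp add: dz dy)
    have "z < y \<longleftrightarrow> a \<in> E"
    proof
      assume "a \<in> E"
      then show "z < y"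
        using less_if_first_different_digit[OF z y eq] a(3) by (simp add: dz dy)
    next
      assume zy: "z < y"
      show "a \<in> E"
      proof (rule ccontr)
        assume "a \<notin> E"
        then have "y < z"
          using less_if_first_different_digit[OF y z eq[symmetric]] a(3) by (simp add: dz dy)
        then show False using zy by simp
      qed
    qed
    also have "a \<in> E \<longleftrightarrow> (\<exists>b\<in>E. x \<in> {1 / 2 ^ b..<2 / 2 ^ b})"
      using a(2) dyadic_interval_unique by blast
    finally show ?thesis unfolding z_def y_def .
  qed
qed

section \<open>From shifted points to dyadic boxes\<close>

lemma dyadic_shift_in_unit_cube:
  assumes "X \<in> unit_cube" "T \<in> dyadic_rational_points s"
  shows "dyadic_shift X T \<in> unit_cube"
  using assms dyadic_add_in[of "X $ i" "T $ i" s for i]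
  by (auto simp: unit_cube_def dyadic_rational_points_def dyadic_shift_def)

lemma inj_on_dyadic_shift:
  assumes T: "T \<in> dyadic_rational_points s"
  shows "inj_on (\<lambda>X. dyadic_shift X T) unit_cube"
proof (rule inj_onI)
  fix X Y assume X: "X \<in> unit_cube" and Y: "Y \<in> unit_cube"
    and eq: "dyadic_shift X T = dyadic_shift Y T"
  have "X $ i = Y $ i" for i
  proof -
    have "T $ i \<in> dyadic_rationals s" using T by (simp add: dyadic_rational_points_def)
    moreover have "dyadic_add (X $ i) (T $ i) = dyadic_add (Y $ i) (T $ i)"
      using eq by (simp add: dyadic_shift_def vec_eq_iff)
    ultimately show ?thesis
      using inj_onD[OF inj_on_dyadic_add, of "T $ i" s "X $ i" "Y $ i"] X Y by (auto simp: unit_cube_def)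
  qed
  then show "X = Y" by (simp add: vec_eq_iff)
qed

text \<open>For positive entries of a these are the points whose i-th coordinate has its leading
  digit at place \<open>a i\<close>. The volume is 2 to the power minus the sum of the
  entries.\<close>

definition dyadic_box :: "('n \<Rightarrow> nat) \<Rightarrow> (real ^ 'n) set" where
  "dyadic_box a = {X. \<forall>i. X $ i \<in> {1 / 2 ^ a i..<2 / 2 ^ a i}}"

definition box_discrepancy :: "(real ^ 'n) set \<Rightarrow> ('n \<Rightarrow> nat) \<Rightarrow> real" where
  "box_discrepancy D a = real (card (D \<inter> dyadic_box a)) - real (card D) / 2 ^ (\<Sum>i\<in>UNIV. a i)"

text \<open>A shifted point falls into the test box iff the original lies in one of the disjoint
  boxes \<open>dyadic_box a\<close> with \<open>a i \<in> E i\<close>. The volume of the test box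
  expands over the same vectors by distributivity.\<close>

lemma local_discrepancy_shift_eq:
  fixes D :: "(real ^ 'n) set"
  assumes fin: "finite D" and D: "D \<subseteq> unit_cube" and E: "\<And>i. E i \<subseteq> {1..s}"
  defines "Y \<equiv> (\<chi> i. dyadic_point (E i)) :: real ^ 'n"
  shows "local_discrepancy (shift_set D Y) Y = (\<Sum>a\<in>PiE UNIV E. box_discrepancy D a)"
proof -
  have fE: "finite (E i)" for i using E finite_subset by blast
  have fP: "finite (PiE UNIV E)" using fE by (intro finite_PiE) auto
  have YQ: "Y \<in> dyadic_rational_points s"
    using dyadic_point_in_rationals[OF E] by (simp add: Y_def dyadic_rational_points_def)
  have inj: "inj_on (\<lambda>X. dyadic_shift X Y) D"
    using inj_on_dyadic_shift[OF YQ] D inj_on_subset by blast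
  have less: "dyadic_shift X Y \<in> anchored_box Y \<longleftrightarrow> (\<exists>a\<in>PiE UNIV E. X \<in> dyadic_box a)"
    if X: "X \<in> D" for X
  proof -
    have Xi: "X $ i \<in> {0..<1}" for i using X D by (auto simp: unit_cube_def)
    have "dyadic_shift X Y \<in> anchored_box Y \<longleftrightarrow> (\<forall>i. \<exists>a\<in>E i. X $ i \<in> {1 / 2 ^ a..<2 / 2 ^ a})"
      using dyadic_add_less_iff[OF E Xi] dyadic_add_in[OF Xi dyadic_point_in_rationals[OF E]]
      by (auto simp: anchored_box_def dyadic_shift_def Y_def)
    \<comment> \<open>The places chosen in the single coordinates form one vector a.\<close>
    also have "\<dots> \<longleftrightarrow> (\<exists>a. \<forall>i. a i \<in> E i \<and> X $ i \<in> {1 / 2 ^ a i..<2 / 2 ^ a i})"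
      unfolding Bex_def by (rule choice_iff)
    finally show ?thesis by (auto simp: dyadic_box_def)
  qed
  have "card (shift_set D Y \<inter> anchored_box Y)
      = card ((\<lambda>X. dyadic_shift X Y) ` {X \<in> D. dyadic_shift X Y \<in> anchored_box Y})"
    unfolding shift_set_def by (rule arg_cong[of _ _ card]) auto
  also have "\<dots> = card {X \<in> D. dyadic_shift X Y \<in> anchored_box Y}"
    using inj by (intro card_image) (auto simp: inj_on_def)
  also have "{X \<in> D. dyadic_shift X Y \<in> anchored_box Y} = (\<Union>a\<in>PiE UNIV E. D \<inter> dyadic_box a)"
    using less by auto
  also have "card \<dots> = (\<Sum>a\<in>PiE UNIV E. card (D \<inter> dyadic_box a))"
  proof (rule card_UN_disjoint[OF fP])
    show "\<forall>a\<in>PiE UNIV E. \<forall>b\<in>PiE UNIV E. a \<noteq> b \<longrightarrow>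
        (D \<inter> dyadic_box a) \<inter> (D \<inter> dyadic_box b) = {}"
      using dyadic_interval_unique unfolding dyadic_box_def by blast
  qed (use fin in auto)
  finally have card: "real (card (shift_set D Y \<inter> anchored_box Y))
      = (\<Sum>a\<in>PiE UNIV E. real (card (D \<inter> dyadic_box a)))" by simp
  have "(\<Prod>i\<in>UNIV. Y $ i) = (\<Prod>i\<in>UNIV. \<Sum>a\<in>E i. 1 / 2 ^ a)"
    by (simp add: Y_def dyadic_point_def)
  also have "\<dots> = (\<Sum>a\<in>PiE UNIV E. \<Prod>i\<in>UNIV. 1 / 2 ^ a i)"
    using fE by (intro prod_sum_PiE) auto
  also have "\<dots> = (\<Sum>a\<in>PiE UNIV E. 1 / 2 ^ (\<Sum>i\<in>UNIV. a i))"
    by (simp add: prod_dividef power_sum)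
  finally have "real (card D) * (\<Prod>i\<in>UNIV. Y $ i)
      = (\<Sum>a\<in>PiE UNIV E. real (card D) / 2 ^ (\<Sum>i\<in>UNIV. a i))"
    by (simp add: sum_distrib_left)
  moreover have "card (shift_set D Y) = card D"
    unfolding shift_set_def by (rule card_image[OF inj])
  ultimately show ?thesis
    by (simp add: local_discrepancy_def card box_discrepancy_def sum_subtractf)
qed

lemma abs_local_discrepancy_le_Linf:
  assumes "finite D" "Y \<in> unit_cube"
  shows "\<bar>local_discrepancy D Y\<bar> \<le> Linf_discrepancy D"
  unfolding Linf_discrepancy_def
  using bdd_above_local_discrepancy[OF assms(1)] assms(2) by (intro cSUP_upper)

lemma Linf_shift_le_mean:
  "T \<in> dyadic_rational_points s \<Longrightarrow> Linf_discrepancy (shift_set D T) \<le> mean_Linf_discrepancy s D"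
  unfolding mean_Linf_discrepancy_def using finite_dyadic_rational_points by (intro Max_ge) auto

lemma mean_Linf_attained:
  "\<exists>T\<in>dyadic_rational_points s. mean_Linf_discrepancy s D = Linf_discrepancy (shift_set D T)"
  using Max_in[of "(\<lambda>T. Linf_discrepancy (shift_set D T)) ` dyadic_rational_points s"]
    finite_dyadic_rational_points dyadic_rational_points_nonempty
  unfolding mean_Linf_discrepancy_def by fastforce

text \<open>The point with digit sets E i serves both as an admissible shift and as a corner in the
  unit cube.\<close>

lemma subset_sum_box_discrepancy_le:
  fixes D :: "(real ^ 'n) set"
  assumes fin: "finite D" and D: "D \<subseteq> unit_cube" and E: "\<And>i. E i \<subseteq> {1..s}"
  shows "\<bar>\<Sum>a\<in>PiE UNIV E. box_discrepancy D a\<bar> \<le> mean_Linf_discrepancy s D"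
proof -
  define Y :: "real ^ 'n" where "Y = (\<chi> i. dyadic_point (E i))"
  have YQ: "Y \<in> dyadic_rational_points s"
    using dyadic_point_in_rationals[OF E] by (simp add: Y_def dyadic_rational_points_def)
  then have "Y \<in> unit_cube"
    using dyadic_rationals_bounds by (fastforce simp: dyadic_rational_points_def unit_cube_def)
  moreover have "finite (shift_set D Y)" using fin by (simp add: shift_set_def)
  ultimately have "\<bar>local_discrepancy (shift_set D Y) Y\<bar> \<le> Linf_discrepancy (shift_set D Y)"
    by (intro abs_local_discrepancy_le_Linf)
  also have "\<dots> \<le> mean_Linf_discrepancy s D" by (rule Linf_shift_le_mean[OF YQ])
  finally show ?thesis
    using local_discrepancy_shift_eq[OF fin D E] by (simp add: Y_def)
qed

text \<open>The discrepancy function jumps by at least 1 at every point of the set.\<close>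

lemma Linf_discrepancy_ge_half:
  fixes D :: "(real ^ 'n) set"
  assumes fin: "finite D" and D: "D \<subseteq> unit_cube" and X: "X \<in> D"
  shows "Linf_discrepancy D \<ge> 1 / 2"
proof -
  define Y where "Y e = (\<chi> i. X $ i + e)" for e :: real
  have Xc: "X \<in> unit_cube" using X D by blast
  have "eventually (\<lambda>e. X $ i + e < 1) (at_right 0)" for i
  proof -
    have "((\<lambda>e. X $ i + e) \<longlongrightarrow> X $ i + 0) (at_right 0)" by (intro tendsto_intros)
    then show ?thesis using Xc by (intro order_tendstoD) (auto simp: unit_cube_def)
  qed
  then have ev: "eventually (\<lambda>e. 0 < e \<and> (\<forall>i. X $ i + e < 1)) (at_right 0)"
    by (simp add: eventually_conj_iff eventually_all_finite eventually_at_right_less)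
  \<comment> \<open>Moving the corner from X to X + e adds at least the point X to the count. The
    volume term tends to 0 with e, and a difference of two local discrepancies is at most twice the
    supremum.\<close>
  have "eventually (\<lambda>e. 1 - real (card D) * ((\<Prod>i\<in>UNIV. X $ i + e) - (\<Prod>i\<in>UNIV. X $ i))
      \<le> 2 * Linf_discrepancy D) (at_right 0)"
    using ev
  proof eventually_elim
    case (elim e)
    then have Yc: "Y e \<in> unit_cube" using Xc by (auto simp: unit_cube_def Y_def)
    have less_add: "z < x + e" if "z < x" for x z :: real
      using that elim by linarith
    have "insert X (D \<inter> anchored_box X) \<subseteq> D \<inter> anchored_box (Y e)"
      using X Xc elim by (auto simp: unit_cube_def anchored_box_def Y_def less_imp_le intro: less_add)
    then have "card (insert X (D \<inter> anchored_box X)) \<le> card (D \<inter> anchored_box (Y e))"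
      using fin by (intro card_mono) auto
    moreover have "X \<notin> anchored_box X" by (simp add: anchored_box_def)
    ultimately have "Suc (card (D \<inter> anchored_box X)) \<le> card (D \<inter> anchored_box (Y e))"
      using fin by simp
    then have "1 - real (card D) * ((\<Prod>i\<in>UNIV. X $ i + e) - (\<Prod>i\<in>UNIV. X $ i))
        \<le> local_discrepancy D (Y e) - local_discrepancy D X"
      unfolding local_discrepancy_def Y_def by (simp add: algebra_simps)
    then show ?case
      using abs_local_discrepancy_le_Linf[OF fin Yc] abs_local_discrepancy_le_Linf[OF fin Xc]
      by linarith
  qed
  moreover have "((\<lambda>e. 1 - real (card D) * ((\<Prod>i\<in>UNIV. X $ i + e) - (\<Prod>i\<in>UNIV. X $ i)))
      \<longlongrightarrow> 1 - real (card D) * ((\<Prod>i\<in>UNIV. X $ i + 0) - (\<Prod>i\<in>UNIV. X $ i))) (at_right 0)"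
    by (intro tendsto_intros)
  ultimately have "1 - real (card D) * ((\<Prod>i\<in>UNIV. X $ i + 0) - (\<Prod>i\<in>UNIV. X $ i))
      \<le> 2 * Linf_discrepancy D"
    by (intro tendsto_upperbound) auto
  then show ?thesis by simp
qed

lemma mean_Linf_discrepancy_ge_half:
  fixes D :: "(real ^ 'n) set"
  assumes fin: "finite D" and D: "D \<subseteq> unit_cube" and ne: "D \<noteq> {}"
  shows "mean_Linf_discrepancy s D \<ge> 1 / 2"
proof -
  have T: "0 \<in> (dyadic_rational_points s :: (real ^ 'n) set)" by (rule dyadic_rational_points_nonempty)
  obtain X where "X \<in> D" using ne by blast
  then have "1 / 2 \<le> Linf_discrepancy (shift_set D 0)"
    using fin D dyadic_shift_in_unit_cube[OF _ T]
    by (intro Linf_discrepancy_ge_half[of _ "dyadic_shift X 0"]) (auto simp: shift_set_def)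
  also have "\<dots> \<le> mean_Linf_discrepancy s D" by (rule Linf_shift_le_mean[OF T])
  finally show ?thesis .
qed

subsection \<open>Numerical estimates\<close>

text \<open>Bernoulli's inequality for real exponents, from Young's inequality for y^q and 1 with
  weights 1/q and 1 - 1/q.\<close>

lemma bernoulli_powr:
  fixes y q :: real
  assumes "y \<ge> 0" "q \<ge> 1"
  shows "1 + q * (y - 1) \<le> y powr q"
proof (cases "y = 0")
  case False
  then have "(y powr q) powr (1 / q) * 1 powr (1 - 1 / q) \<le> 1 / q * y powr q + (1 - 1 / q) * 1"
    using assms by (intro Youngs_inequality_0) auto
  then have "y \<le> 1 / q * y powr q + (1 - 1 / q)" using assms by (simp add: powr_powr)
  then have "q * y \<le> q * (1 / q * y powr q + (1 - 1 / q))"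
    using assms by (intro mult_left_mono) auto
  also have "\<dots> = y powr q + q - 1" using assms by (simp add: right_diff_distrib distrib_left)
  finally show ?thesis by (simp add: right_diff_distrib)
qed (use assms in auto)

lemma powr_diff_le:
  fixes x q :: real
  assumes "x \<ge> 1" "q \<ge> 1"
  shows "x powr q - (x - 1) powr q \<le> q * x powr (q - 1)"
proof -
  have "x powr q * (1 + q * ((x - 1) / x - 1)) \<le> x powr q * ((x - 1) / x) powr q"
    using assms by (intro mult_left_mono bernoulli_powr) auto
  also have "\<dots> = (x - 1) powr q"
    using assms by (simp add: powr_divide)
  also have "x powr q * (1 + q * ((x - 1) / x - 1)) = x powr q - q * x powr (q - 1)"
    using assms by (simp add: powr_diff field_simps)
  finally show ?thesis by linarith
qed

text \<open>Telescoping \<open>powr_diff_le\<close> does the work of comparing the sum with the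
  integral of x^(q - 1).\<close>

lemma sum_powr_ge:
  fixes q :: real
  assumes "k \<le> M" "q \<ge> 1"
  shows "real M powr q - real k powr q \<le> q * (\<Sum>j\<in>{Suc k..M}. real j powr (q - 1))"
  using assms(1)
proof (induction rule: dec_induct)
  case (step M)
  then show ?case
    using powr_diff_le[of "real (Suc M)" q] assms(2) by (simp add: algebra_simps)
qed simp

section \<open>The constant \<open>gamma_inf\<close> in the two ranges of log N\<close>

lemma square_le_six_times_two_power: "1 \<le> m \<Longrightarrow> (m + 2)\<^sup>2 \<le> 6 * 2 ^ m" for m :: nat
proof (induction m rule: nat_induct_at_least)
  case (Suc m)
  then have "(Suc m + 2)\<^sup>2 \<le> 2 * (m + 2)\<^sup>2" by (simp add: power2_eq_square algebra_simps)
  then show ?case using Suc by simp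
qed (simp add: power2_eq_square)

lemma square_less_four_times_two_power: "m\<^sup>2 < 4 * 2 ^ m" for m :: nat
\<comment> \<open>The induction step needs (m + 1)^2 \<le> 2 m^2, which holds only from m = 3
  on.\<close>
proof (cases "m < 3")
  case True
  then have "m = 0 \<or> m = 1 \<or> m = 2" by auto
  then show ?thesis by auto
next
  case False
  then have "3 \<le> m" by simp
  then show ?thesis
  proof (induction m rule: nat_induct_at_least)
    case (Suc m)
    have "(Suc m)\<^sup>2 = m\<^sup>2 + 2 * m + 1" by (simp add: power2_eq_square)
    moreover have "3 * m \<le> m\<^sup>2" using Suc by (simp add: power2_eq_square)
    ultimately have "(Suc m)\<^sup>2 \<le> 2 * m\<^sup>2" using Suc by linarith
    then show ?case using Suc by simp
  qed simp
qed

lemma two_powr_half_squared: "(2 powr (real m / 2))\<^sup>2 = (2::real) ^ m"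
proof -
  have "(2 powr (real m / 2))\<^sup>2 = (2::real) powr (real m / 2 + real m / 2)"
    unfolding powr_add power2_eq_square ..
  then show ?thesis by (simp add: powr_realpow)
qed

lemma eight_powr: "8 powr x = (2::real) powr (3 * x)"
  using powr_powr[of 2 3 x] by simp

lemma gamma_inf_add_two:
  "gamma_inf (m + 2) = 2 powr (- 2 * real (m + 2) - 1) * inverse (real m powr (real m / 2))"
  unfolding powr_minus[symmetric] by (simp add: gamma_inf_def)

text \<open>At the endpoint l = 8m the powers of m cancel up to one factor and the bound equals m /
  (4 * 2^(m/2)), so the claim becomes m^2 < 4 * 2^m.\<close>

lemma gamma_inf_mult_powr_less_half:
  assumes m: "m \<ge> 1" and l: "0 \<le> l" "l \<le> 8 * real m"
  shows "gamma_inf (m + 2) * l powr (real (m + 2) / 2) < 1 / 2"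
proof -
  have half: "real (m + 2) / 2 = real m / 2 + 1" by simp
  have cancel: "a * inverse c * (b * (c * r)) = a * b * r" if "c \<noteq> 0" for a b c r :: real
    using that by simp
  have "gamma_inf (m + 2) * l powr (real (m + 2) / 2)
      \<le> gamma_inf (m + 2) * (8 * real m) powr (real (m + 2) / 2)"
    using l by (intro mult_left_mono powr_mono2) (auto simp: gamma_inf_def)
  also have "(8 * real m) powr (real (m + 2) / 2)
      = 2 powr (3 * (real m / 2 + 1)) * (real m powr (real m / 2) * real m)"
  proof -
    have "(8 * real m) powr (real (m + 2) / 2) = 8 powr (real m / 2 + 1) * real m powr (real m / 2 + 1)"
      unfolding half by (rule powr_mult)
    also have "real m powr (real m / 2 + 1) = real m powr (real m / 2) * real m"
      unfolding powr_add by simp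
    finally show ?thesis by (simp only: eight_powr)
  qed
  also have "gamma_inf (m + 2) * \<dots>
      = 2 powr (- 2 * real (m + 2) - 1) * 2 powr (3 * (real m / 2 + 1)) * real m"
    unfolding gamma_inf_add_two using m by (intro cancel) simp
  also have "\<dots> = 2 powr (- 2 * real (m + 2) - 1 + 3 * (real m / 2 + 1)) * real m"
    by (simp only: powr_add)
  also have "- 2 * real (m + 2) - 1 + 3 * (real m / 2 + 1) = - (2 + real m / 2)"
    by (simp add: field_simps)
  also have "2 powr - (2 + real m / 2) * real m = real m / (4 * 2 powr (real m / 2))"
    unfolding powr_minus powr_add by (simp add: field_simps)
  also have "\<dots> < 1 / 2"
  proof -
    have "real (m\<^sup>2) < real (4 * 2 ^ m)"
      by (simp only: of_nat_less_iff square_less_four_times_two_power)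
    then have "(real m)\<^sup>2 < (2 * 2 powr (real m / 2))\<^sup>2"
      by (simp only: power_mult_distrib two_powr_half_squared) simp
    then have "real m < 2 * 2 powr (real m / 2)" by (rule power_less_imp_less_base) simp
    then show ?thesis by (simp add: field_simps)
  qed
  finally show ?thesis .
qed

text \<open>Since j choose m is at least (j/m)^m, the sum dominates a power sum with exponent m/2 =
  q - 1.\<close>

lemma sum_sqrt_binomial_ge:
  assumes m: "m \<ge> 1" and M: "m \<le> Suc M"
  defines "q \<equiv> real (m + 2) / 2"
  shows "(real M powr q - real m powr q) / q \<le> real m powr (real m / 2) * (\<Sum>j\<in>{m..M}. sqrt (real (j choose m)))"
proof -
  have q: "q \<ge> 1" "q - 1 = real m / 2" by (auto simp: q_def add_divide_distrib)
  \<comment> \<open>Lowering m to m - 1 makes the range of summation start at j = m.\<close>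
  have "real M powr q - real m powr q \<le> real M powr q - real (m - 1) powr q"
    using q by (simp add: powr_mono2)
  also have "\<dots> \<le> q * (\<Sum>j\<in>{m..M}. real j powr (q - 1))"
    using sum_powr_ge[of "m - 1" M q] m M q(1) by simp
  finally have "(real M powr q - real m powr q) / q \<le> (\<Sum>j\<in>{m..M}. real j powr (q - 1))"
    using q(1) by (simp add: divide_le_eq mult.commute)
  also have "\<dots> \<le> (\<Sum>j\<in>{m..M}. real m powr (real m / 2) * sqrt (real (j choose m)))"
  proof (rule sum_mono)
    fix j assume j: "j \<in> {m..M}"
    have "sqrt ((real j / real m) ^ m) \<le> sqrt (real (j choose m))"
      using binomial_ge_n_over_k_pow_k[of m j, where ?'a = real] j by simp
    moreover have "sqrt ((real j / real m) ^ m) = real j powr (real m / 2) / real m powr (real m / 2)"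
      using j m by (simp add: powr_half_sqrt[symmetric] powr_powr powr_divide flip: powr_realpow)
    ultimately have "real j powr (real m / 2) / real m powr (real m / 2) \<le> sqrt (real (j choose m))"
      by (simp only:)
    then show "real j powr (q - 1) \<le> real m powr (real m / 2) * sqrt (real (j choose m))"
      unfolding q(2) using m by (simp add: divide_le_eq mult.commute)
  qed
  finally show ?thesis by (simp add: sum_distrib_left)
qed

text \<open>The constant collapses to 2^(-(m+5)/2) m^(-m/2). From M^q \<ge> 23/32 l^q and m^q \<le>
  1/16 l^q the difference is at least 21/32 l^q, and what remains is 16 (m + 2) < 7 *
  2^((m+5)/2).\<close>

lemma gamma_inf_less_sum_sqrt_binomial:
  assumes m: "m \<ge> 1" and l: "8 * real m < l" and M: "l - 3 / 2 \<le> real M"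
  shows "2 * sqrt 8 ^ Suc m * (gamma_inf (m + 2) * l powr (real (m + 2) / 2))
           < (\<Sum>j\<in>{m..M}. sqrt (real (j choose m)) / 3)"
proof -
  define q where "q = real (m + 2) / 2"
  have q: "q \<ge> 3 / 2" using m by (simp add: q_def)
  have l8: "l > 8" using m l by linarith
  have "8 * real m < real M + 3 / 2" using l M by linarith
  then have mM: "m \<le> Suc M" using m by linarith
  have "sqrt 8 = 2 powr (3 / 2)"
    using eight_powr[of "1 / 2"] by (simp add: powr_half_sqrt)
  then have "sqrt 8 powr real (Suc m) = 2 powr (3 / 2 * real (Suc m))"
    by (simp only: powr_powr)
  then have s8: "sqrt 8 ^ Suc m = 2 powr (3 / 2 * real (Suc m))"
    by (subst powr_realpow[symmetric]) auto
  have "2 * sqrt 8 ^ Suc m * gamma_inf (m + 2) = 2 powr 1 * 2 powr (3 / 2 * real (Suc m))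
      * 2 powr (- 2 * real (m + 2) - 1) * inverse (real m powr (real m / 2))"
    unfolding s8 gamma_inf_add_two powr_one[OF zero_le_numeral] by (simp only: mult.assoc)
  also have "\<dots> = 2 powr (1 + 3 / 2 * real (Suc m) + (- 2 * real (m + 2) - 1))
      * inverse (real m powr (real m / 2))"
    by (simp only: powr_add)
  also have "1 + 3 / 2 * real (Suc m) + (- 2 * real (m + 2) - 1) = - (real (m + 5) / 2)"
    by (simp add: field_simps)
  finally have const: "2 * sqrt 8 ^ Suc m * gamma_inf (m + 2)
      = 1 / 2 powr (real (m + 5) / 2) / real m powr (real m / 2)"
    by (simp only: powr_minus divide_inverse mult_1_left)

  \<comment> \<open>The relative loss in Bernoulli's inequality is 3q / (2l); it is at most 9/32
    because 2q = m + 2 \<le> 3m and m < l/8.\<close>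
  have "l powr q * (1 - 9 / 32) \<le> l powr q * (1 + q * ((l - 3 / 2) / l - 1))"
  proof (rule mult_left_mono)
    have "real m + 2 \<le> 3 * real m" using m by simp
    then have "3 * q / 2 \<le> 9 / 32 * l" using l by (simp add: q_def)
    then have "3 * q / 2 / l \<le> 9 / 32" using l8 by (simp add: divide_le_eq)
    moreover have "q * ((l - 3 / 2) / l - 1) = - (3 * q / 2 / l)"
      using l8 by (simp add: diff_divide_distrib)
    ultimately show "1 - 9 / 32 \<le> 1 + q * ((l - 3 / 2) / l - 1)" by linarith
  qed simp
  also have "\<dots> \<le> l powr q * ((l - 3 / 2) / l) powr q"
    using l8 q by (intro mult_left_mono bernoulli_powr) auto
  also have "\<dots> = (l - 3 / 2) powr q" using l8 by (simp add: powr_divide)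
  also have "\<dots> \<le> real M powr q" using l8 M q by (intro powr_mono2) auto
  finally have Mq: "23 / 32 * l powr q \<le> real M powr q" by simp

  have "real m powr q \<le> (l / 8) powr q" using l q by (intro powr_mono2) auto
  also have "\<dots> = l powr q / 8 powr q" using l8 by (simp add: powr_divide)
  also have "\<dots> \<le> l powr q / 16"
  proof (rule divide_left_mono)
    have "(16::real) = 2 powr 4" by simp
    also have "\<dots> \<le> 2 powr (3 * q)" using q by (intro powr_mono) auto
    also have "\<dots> = 8 powr q" by (rule eight_powr[symmetric])
    finally show "(16::real) \<le> 8 powr q" .
  qed simp_all
  finally have mq: "real m powr q \<le> l powr q / 16" .

  \<comment> \<open>This is the remaining inequality squared and divided by 32.\<close>
  have "8 * (m + 2)\<^sup>2 \<le> 48 * 2 ^ m" using square_le_six_times_two_power[OF m] by simp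
  then have "8 * (m + 2)\<^sup>2 < 49 * 2 ^ m"
    using zero_less_power[of "2::nat" m] by linarith
  then have "real (8 * (m + 2)\<^sup>2) < real (49 * 2 ^ m)" by (simp only: of_nat_less_iff)
  then have "(16 * real (m + 2))\<^sup>2 < (7 * 2 powr (real (m + 5) / 2))\<^sup>2"
    by (simp only: power_mult_distrib two_powr_half_squared) (simp add: power_add)
  then have "16 * real (m + 2) < 7 * 2 powr (real (m + 5) / 2)"
    by (rule power_less_imp_less_base) simp
  then have "1 / 2 powr (real (m + 5) / 2) < 21 / 32 / (3 * q)"
    by (simp add: q_def field_simps)
  then have "l powr q * (1 / 2 powr (real (m + 5) / 2)) < l powr q * (21 / 32 / (3 * q))"
    using l8 by (intro mult_strict_left_mono) auto
  also have "\<dots> = (23 / 32 * l powr q - l powr q / 16) / (3 * q)" by simp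
  also have "\<dots> \<le> (real M powr q - real m powr q) / (3 * q)"
    using Mq mq q by (intro divide_right_mono diff_mono) auto
  also have "\<dots> = (real M powr q - real m powr q) / q / 3" by simp
  also have "\<dots> \<le> real m powr (real m / 2) * (\<Sum>j\<in>{m..M}. sqrt (real (j choose m))) / 3"
    unfolding q_def by (intro divide_right_mono sum_sqrt_binomial_ge m mM) simp
  finally have *: "l powr q * (1 / 2 powr (real (m + 5) / 2))
      < real m powr (real m / 2) * (\<Sum>j\<in>{m..M}. sqrt (real (j choose m))) / 3" .
  have "2 * sqrt 8 ^ Suc m * (gamma_inf (m + 2) * l powr q)
      = l powr q * (1 / 2 powr (real (m + 5) / 2)) / real m powr (real m / 2)"
    unfolding mult.assoc[symmetric] const by simp
  also have "\<dots> < real m powr (real m / 2) * (\<Sum>j\<in>{m..M}. sqrt (real (j choose m))) / 3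
      / real m powr (real m / 2)"
    using m by (intro divide_strict_right_mono *) auto
  also have "\<dots> = (\<Sum>j\<in>{m..M}. sqrt (real (j choose m)) / 3)"
    using m by (simp flip: sum_divide_distrib)
  finally show ?thesis unfolding q_def .
qed

subsection \<open>The lower bound\<close>

text \<open>The expected count lies in [1/3, 2/3), while the actual count is 0 or at least
  1.\<close>

lemma abs_box_discrepancy_ge:
  assumes "2 ^ n \<le> 3 * card D" "3 * card D < 2 ^ Suc n" "(\<Sum>i\<in>UNIV. a i) = n"
  shows "1 / 3 \<le> \<bar>box_discrepancy D a\<bar>"
proof -
  have "real (2 ^ n) \<le> real (3 * card D)" "real (3 * card D) < real (2 ^ Suc n)"
    using assms(1,2) by (simp_all only: of_nat_le_iff of_nat_less_iff)
  then have "1 / 3 \<le> real (card D) / 2 ^ n" "real (card D) / 2 ^ n < 2 / 3"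
    by (simp_all add: field_simps)
  moreover have "real k = 0 \<or> real k \<ge> 1" for k by (cases k) auto
  then have "real (card (D \<inter> dyadic_box a)) = 0 \<or> real (card (D \<inter> dyadic_box a)) \<ge> 1" .
  ultimately show ?thesis unfolding box_discrepancy_def assms(3) by linarith
qed

text \<open>If the optimised coordinate i has the value n - 1 - j, the other m + 1 coordinates must
  sum to j + 1. At least j choose m vectors do so, each adding at least 1/9 to the squared l^2 norm.
  The limit j \<le> n - 2 keeps the value at i positive.\<close>

lemma sum_sqrt_binomial_le_mean:
  fixes D :: "(real ^ 'n) set"
  assumes d: "CARD('n) = m + 2" and fin: "finite D" and D: "D \<subseteq> unit_cube"
    and n: "2 ^ n \<le> 3 * card D" "3 * card D < 2 ^ Suc n" "n \<le> s" "n \<ge> 2"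
  shows "(\<Sum>j\<in>{m..n - 2}. sqrt (real (j choose m)) / 3) \<le> 2 * sqrt 8 ^ Suc m * mean_Linf_discrepancy s D"
proof -
  obtain i :: 'n where True by blast
  define I where "I = UNIV - {i}"
  have I: "finite I" "i \<notin> I" "insert i I = UNIV" "card I = Suc m"
    using d by (auto simp: I_def card_Diff_singleton)
  let ?P = "PiE I (\<lambda>_. {1..s})"
  define h where "h b = sqrt (\<Sum>a\<in>?P. box_discrepancy D (a(i := b)) ^ 2)" for b
  have "sqrt (real (j choose m)) / 3 \<le> h (n - 1 - j)" if j: "j \<in> {m..n - 2}" for j
  proof -
    define C where "C = {a \<in> ?P. sum a I = Suc j}"
    have "j choose m \<le> card C"
      unfolding C_def using I(1,4) n j by (intro card_compositions_ge) auto
    then have "real (j choose m) * (1 / 3)\<^sup>2 \<le> (\<Sum>a\<in>C. (1 / 3)\<^sup>2)"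
      by simp
    also have "\<dots> \<le> (\<Sum>a\<in>C. box_discrepancy D (a(i := n - 1 - j)) ^ 2)"
    proof (rule sum_mono)
      fix a assume a: "a \<in> C"
      have "(\<Sum>k\<in>UNIV. (a(i := n - 1 - j)) k) = n - 1 - j + (\<Sum>k\<in>I. (a(i := n - 1 - j)) k)"
        unfolding I(3)[symmetric] sum.insert[OF I(1,2)] by simp
      also have "(\<Sum>k\<in>I. (a(i := n - 1 - j)) k) = sum a I"
        using I(2) by (intro sum.cong) auto
      finally have "(\<Sum>k\<in>UNIV. (a(i := n - 1 - j)) k) = n"
        using a j n(4) by (auto simp: C_def)
      then have "1 / 3 \<le> \<bar>box_discrepancy D (a(i := n - 1 - j))\<bar>"
        by (rule abs_box_discrepancy_ge[OF n(1,2)])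
      then have "(1 / 3)\<^sup>2 \<le> \<bar>box_discrepancy D (a(i := n - 1 - j))\<bar>\<^sup>2"
        by (rule power_mono) simp
      then show "(1 / 3)\<^sup>2 \<le> (box_discrepancy D (a(i := n - 1 - j)))\<^sup>2" by simp
    qed
    also have "\<dots> \<le> (\<Sum>a\<in>?P. box_discrepancy D (a(i := n - 1 - j)) ^ 2)"
      using I(1) by (intro sum_mono2) (auto simp: C_def intro!: finite_PiE)
    finally have "sqrt (real (j choose m) * (1 / 3)\<^sup>2) \<le> h (n - 1 - j)"
      unfolding h_def by (rule real_sqrt_le_mono)
    then show ?thesis by (simp only: real_sqrt_mult real_sqrt_abs)
  qed
  then have "(\<Sum>j\<in>{m..n - 2}. sqrt (real (j choose m)) / 3) \<le> (\<Sum>j\<in>{m..n - 2}. h (n - 1 - j))"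
    by (rule sum_mono)
  \<comment> \<open>The values n - 1 - j are distinct and lie in {1..s}; the other terms
    \<open>h b\<close> are nonnegative.\<close>
  also have "\<dots> = (\<Sum>b\<in>(\<lambda>j. n - 1 - j) ` {m..n - 2}. h b)"
    using n(4) by (subst sum.reindex) (auto simp: inj_on_def)
  also have "\<dots> \<le> (\<Sum>b\<in>{1..s}. h b)"
    using n by (intro sum_mono2) (auto simp: h_def sum_nonneg)
  also have "\<dots> \<le> 2 * sqrt 8 ^ card I * mean_Linf_discrepancy s D"
    unfolding h_def
  proof (rule sum_sqrt_le_of_subset_sums[OF I(1,2)])
    fix E assume "E \<in> PiE (insert i I) (\<lambda>_. Pow {1..s})"
    then show "\<bar>\<Sum>a\<in>PiE (insert i I) E. box_discrepancy D a\<bar> \<le> mean_Linf_discrepancy s D"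
      unfolding I(3) by (intro subset_sum_box_discrepancy_le[OF fin D]) auto
  qed simp
  finally show ?thesis by (simp only: I(4))
qed

theorem theorem2p3:
  fixes D :: "(real ^ 'n) set" and d N s :: nat
  assumes "CARD('n) = d" and "d \<ge> 3"
    and "finite D" and "D \<subseteq> unit_cube" and "card D = N" and "N \<ge> 1"
    and "real s \<ge> log 2 (real N) + 1 / 2 * (real d - 2) * log 2 (real d - 2)
                    + 2 * real d + log 2 (real d)"
  shows "mean_Linf_discrepancy s D > gamma_inf d * log 2 (real N) powr (real d / 2) \<and>
         (\<exists>T\<in>dyadic_rational_points s.
            Linf_discrepancy (shift_set D T) > gamma_inf d * log 2 (real N) powr (real d / 2))"
proof -
  define m where "m = d - 2"
  have m: "d = m + 2" "m \<ge> 1" using assms(2) by (auto simp: m_def)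
  define l where "l = log 2 (real N)"
  have l0: "l \<ge> 0" using assms(6) by (simp add: l_def)
  have "gamma_inf d * l powr (real d / 2) < mean_Linf_discrepancy s D"
  proof (cases "l \<le> 8 * real m")
    case True
    have "D \<noteq> {}" using assms(5,6) by auto
    then show ?thesis
      using mean_Linf_discrepancy_ge_half[OF assms(3,4), of s] gamma_inf_mult_powr_less_half[OF m(2) l0 True]
      unfolding m(1) by linarith
  next
    case False
    then have l8: "8 * real m < l" by simp
    obtain n where n: "2 ^ n \<le> 3 * card D" "3 * card D < 2 ^ Suc n"
      using ex_power_ivl1[of 2 "3 * card D"] assms(5,6) by auto
    then have n': "real (2 ^ n) \<le> real (3 * N)" "real (3 * N) < real (2 ^ Suc n)"
      unfolding assms(5) by (simp_all only: of_nat_le_iff of_nat_less_iff)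
    \<comment> \<open>From 2^n \<le> 4N follows n \<le> 2 + l \<le> s, so the shifts have enough
      digits for boxes of total order n.\<close>
    have "real n = log 2 (2 ^ n)" by simp
    also have "\<dots> \<le> log 2 (4 * real N)" using n' assms(6) by (intro log_mono) auto
    also have "\<dots> = 2 + l" using assms(6) log_pow_cancel[of 2 2] by (simp add: log_mult l_def)
    also have "\<dots> \<le> real s"
    proof -
      have "0 \<le> log 2 (real d - 2)" "0 \<le> log 2 (real d)" using assms(2) by simp_all
      moreover have "0 \<le> 1 / 2 * (real d - 2) * log 2 (real d - 2)"
        using calculation assms(2) by (intro mult_nonneg_nonneg) auto
      ultimately show ?thesis using assms(2,7) unfolding l_def by linarith
    qed
    finally have ns: "n \<le> s" by simp
    \<comment> \<open>Since 2^n > 3N/2 \<ge> sqrt 2 * N, n is at least l + 1/2; this is the source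
      of l - 3/2 as a lower bound for n - 2.\<close>
    have "sqrt 2 \<le> 3 / 2" by (rule real_le_lsqrt) (auto simp: power2_eq_square)
    then have "sqrt 2 * real N \<le> 2 ^ n"
      using n'(2) mult_right_mono[of "sqrt 2" "3 / 2" "real N"] by (simp del: real_sqrt_le_iff)
    then have "log 2 (sqrt 2 * real N) \<le> log 2 (2 ^ n)" using assms(6) by (intro log_mono) auto
    moreover have "log 2 (sqrt 2) = 1 / 2"
      using log_powr_cancel[of 2 "1 / 2"] by (simp add: powr_half_sqrt)
    ultimately have "1 / 2 + l \<le> real n"
      using assms(6) by (simp add: log_mult l_def)
    moreover have "8 < l" using l8 m(2) by linarith
    ultimately have n2: "n \<ge> 2" and nl: "l - 3 / 2 \<le> real (n - 2)" by linarith+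
    have "2 * sqrt 8 ^ Suc m * (gamma_inf (m + 2) * l powr (real (m + 2) / 2))
        < 2 * sqrt 8 ^ Suc m * mean_Linf_discrepancy s D"
      using gamma_inf_less_sum_sqrt_binomial[OF m(2) l8 nl]
        sum_sqrt_binomial_le_mean[OF assms(1)[unfolded m(1)] assms(3,4) n ns n2]
      by (rule less_le_trans)
    then show ?thesis unfolding m(1) by (rule mult_left_less_imp_less) simp
  qed
  moreover obtain T where "T \<in> dyadic_rational_points s"
    "mean_Linf_discrepancy s D = Linf_discrepancy (shift_set D T)"
    using mean_Linf_attained by blast
  ultimately show ?thesis unfolding l_def by metis
qed

end
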